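(* Let $K$ be a finite-dimensional ribbon Hopf algebra over $\mathbb F$ with $R$-matrix $R$ and equip the vector space $K^*$ with the algebra structure $$\beta\cdot'\alpha=\langle\alpha_{(1)}\otimes S(\beta_{(3)}),R\rangle\,\langle\alpha_{(2)}\otimes\beta_{(1)},R\rangle\;\alpha_{(3)}\beta_{(2)}\qquad(\alpha,\beta\in K^* ).$$ Then the linear map $D:K^*\to K$, $D(\alpha)=\langle S^{-1}(\alpha),Q_{(1)}\rangle\,Q_{(2)}$ with $Q=R_{21}R$ is an algebra homomorphism from $(K^*,\cdot')$ to $K^{op}$. It is an isomorphism if and only if $K$ is factorisable.
   Context: $\mathbb F$ is a field of characteristic zero; Sweedler notation without summation signs is used, also for elements of $K\otimes K$ such as $R=R_{(1)}\otimes R_{(2)}$, $Q=Q_{(1)}\otimes Q_{(2)}$; $R_{21}=R_{(2)}\otimes R_{(1)}$. The right-hand side uses the multiplication and comultiplication of the dual Hopf algebra $K^*$, and $\langle\alpha\otimes\beta,R\rangle=\langle\alpha,R_{(1)}\rangle\langle\beta,R_{(2)}\rangle$. An $R$-matrix is an invertible $R\in K\otimes K$ with $R\,\Delta(h)=\Delta^{op}(h)\,R$, $(\Delta\otimes\mathrm{id})(R)=R_{13}R_{23}$, $(\mathrm{id}\otimes\Delta)(R)=R_{13}R_{12}$. With $u=S(R_{(2)})R_{(1)}$, $K$ is ribbon if there is a central invertible $\nu\in K$ with $uS(u)=\nu^2$, $\epsilon(\nu)=1$, $S(\nu)=\nu$, $\Delta(\nu)=R^{-1}R_{21}^{-1}(\nu\otimes\nu)$.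 $K$ is factorisable if the map $K^*\to K$, $\alpha\mapsto Q_{(1)}\langle\alpha,Q_{(2)}\rangle$ is a linear isomorphism. $K^{op}$ is $K$ with the opposite multiplication. *)

theory Defs
  imports Complex_Main "HOL-Library.Function_Algebras"
begin

section \<open>Algebras and their homomorphisms\<close>

text \<open>
  A (unital, associative) algebra is given by the scalar multiplication \<open>s\<close> of an ambient vector
  space, a carrier subspace \<open>A\<close>, a product \<open>m\<close> and a unit \<open>e\<close>.  The carrier is needed because the
  dual of a vector space is a proper subset of a function type.
\<close>

definition algebra_on ::
  "('f::field \<Rightarrow> 'a::ab_group_add \<Rightarrow> 'a) \<Rightarrow> 'a set \<Rightarrow> ('a \<Rightarrow> 'a \<Rightarrow> 'a) \<Rightarrow> 'a \<Rightarrow> bool" where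
  "algebra_on s A m e \<longleftrightarrow>
     vector_space s \<and> module.subspace s A \<and> e \<in> A \<and>
     (\<forall>x\<in>A. \<forall>y\<in>A. m x y \<in> A) \<and>
     (\<forall>x\<in>A. \<forall>y\<in>A. \<forall>z\<in>A. m (x + y) z = m x z + m y z \<and> m x (y + z) = m x y + m x z) \<and>
     (\<forall>c. \<forall>x\<in>A. \<forall>y\<in>A. m (s c x) y = s c (m x y) \<and> m x (s c y) = s c (m x y)) \<and>
     (\<forall>x\<in>A. \<forall>y\<in>A. \<forall>z\<in>A. m (m x y) z = m x (m y z)) \<and>
     (\<forall>x\<in>A. m e x = x \<and> m x e = x)"

definition linear_map_on ::
  "('f::field \<Rightarrow> 'a::ab_group_add \<Rightarrow> 'a) \<Rightarrow> 'a set \<Rightarrow> ('f \<Rightarrow> 'b::ab_group_add \<Rightarrow> 'b) \<Rightarrow> 'b set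
     \<Rightarrow> ('a \<Rightarrow> 'b) \<Rightarrow> bool" where
  "linear_map_on s A s' B f \<longleftrightarrow>
     f ` A \<subseteq> B \<and> (\<forall>x\<in>A. \<forall>y\<in>A. f (x + y) = f x + f y) \<and> (\<forall>c. \<forall>x\<in>A. f (s c x) = s' c (f x))"

definition linear_iso_on ::
  "('f::field \<Rightarrow> 'a::ab_group_add \<Rightarrow> 'a) \<Rightarrow> 'a set \<Rightarrow> ('f \<Rightarrow> 'b::ab_group_add \<Rightarrow> 'b) \<Rightarrow> 'b set
     \<Rightarrow> ('a \<Rightarrow> 'b) \<Rightarrow> bool" where
  "linear_iso_on s A s' B f \<longleftrightarrow> linear_map_on s A s' B f \<and> bij_betw f A B"

definition algebra_hom ::
  "('f::field \<Rightarrow> 'a::ab_group_add \<Rightarrow> 'a) \<Rightarrow> 'a set \<Rightarrow> ('a \<Rightarrow> 'a \<Rightarrow> 'a) \<Rightarrow> 'a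
     \<Rightarrow> ('f \<Rightarrow> 'b::ab_group_add \<Rightarrow> 'b) \<Rightarrow> 'b set \<Rightarrow> ('b \<Rightarrow> 'b \<Rightarrow> 'b) \<Rightarrow> 'b
     \<Rightarrow> ('a \<Rightarrow> 'b) \<Rightarrow> bool" where
  "algebra_hom s A m e s' B m' e' f \<longleftrightarrow>
     algebra_on s A m e \<and> algebra_on s' B m' e' \<and> linear_map_on s A s' B f \<and>
     (\<forall>x\<in>A. \<forall>y\<in>A. f (m x y) = m' (f x) (f y)) \<and> f e = e'"

definition algebra_iso ::
  "('f::field \<Rightarrow> 'a::ab_group_add \<Rightarrow> 'a) \<Rightarrow> 'a set \<Rightarrow> ('a \<Rightarrow> 'a \<Rightarrow> 'a) \<Rightarrow> 'a
     \<Rightarrow> ('f \<Rightarrow> 'b::ab_group_add \<Rightarrow> 'b) \<Rightarrow> 'b set \<Rightarrow> ('b \<Rightarrow> 'b \<Rightarrow> 'b) \<Rightarrow> 'b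
     \<Rightarrow> ('a \<Rightarrow> 'b) \<Rightarrow> bool" where
  "algebra_iso s A m e s' B m' e' f \<longleftrightarrow>
     algebra_hom s A m e s' B m' e' f \<and> bij_betw f A B"


section \<open>Tensor products\<close>

text \<open>
  The list \<open>[(a\<^sub>1, b\<^sub>1), \<dots>, (a\<^sub>n, b\<^sub>n)]\<close> stands for the formal sum of the pure tensors
  \<open>a\<^sub>i \<otimes> b\<^sub>i\<close> (a scalar coefficient can be absorbed into \<open>a\<^sub>i\<close>).  The tensor product is the quotient
  of the formal sums by the congruence generated by multilinearity; its elements are
  equivalence classes, so that equality of tensors is equality in HOL.
\<close>

inductive formal_sum_cong :: "('t list \<Rightarrow> 't list \<Rightarrow> bool) \<Rightarrow> 't list \<Rightarrow> 't list \<Rightarrow> bool"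
  for G where
  gen: "G xs ys \<Longrightarrow> formal_sum_cong G xs ys"
| refl: "formal_sum_cong G xs xs"
| sym: "formal_sum_cong G xs ys \<Longrightarrow> formal_sum_cong G ys xs"
| trans: "formal_sum_cong G xs ys \<Longrightarrow> formal_sum_cong G ys zs \<Longrightarrow> formal_sum_cong G xs zs"
| comm: "formal_sum_cong G (xs @ ys) (ys @ xs)"
| append: "formal_sum_cong G xs ys \<Longrightarrow> formal_sum_cong G (xs @ zs) (ys @ zs)"

inductive bilinear_rel ::
  "('f \<Rightarrow> 'k::ab_group_add \<Rightarrow> 'k) \<Rightarrow> ('k \<times> 'k) list \<Rightarrow> ('k \<times> 'k) list \<Rightarrow> bool"
  for s where
  "bilinear_rel s [(a + a', b)] [(a, b), (a', b)]"
| "bilinear_rel s [(a, b + b')] [(a, b), (a, b')]"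
| "bilinear_rel s [(s c a, b)] [(a, s c b)]"
| "bilinear_rel s [(0, b)] []"

inductive trilinear_rel ::
  "('f \<Rightarrow> 'k::ab_group_add \<Rightarrow> 'k) \<Rightarrow> ('k \<times> 'k \<times> 'k) list \<Rightarrow> ('k \<times> 'k \<times> 'k) list \<Rightarrow> bool"
  for s where
  "trilinear_rel s [(a + a', b, d)] [(a, b, d), (a', b, d)]"
| "trilinear_rel s [(a, b + b', d)] [(a, b, d), (a, b', d)]"
| "trilinear_rel s [(a, b, d + d')] [(a, b, d), (a, b, d')]"
| "trilinear_rel s [(s c a, b, d)] [(a, s c b, d)]"
| "trilinear_rel s [(a, s c b, d)] [(a, b, s c d)]"
| "trilinear_rel s [(0, b, d)] []"

definition tensor2 ::
  "('f \<Rightarrow> 'k::ab_group_add \<Rightarrow> 'k) \<Rightarrow> ('k \<times> 'k) list \<Rightarrow> ('k \<times> 'k) list set" where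
  "tensor2 s xs = {ys. formal_sum_cong (bilinear_rel s) xs ys}"

definition tensor3 ::
  "('f \<Rightarrow> 'k::ab_group_add \<Rightarrow> 'k) \<Rightarrow> ('k \<times> 'k \<times> 'k) list \<Rightarrow> ('k \<times> 'k \<times> 'k) list set" where
  "tensor3 s xs = {ys. formal_sum_cong (trilinear_rel s) xs ys}"

definition tensor_square :: "('f \<Rightarrow> 'k::ab_group_add \<Rightarrow> 'k) \<Rightarrow> ('k \<times> 'k) list set set" where
  "tensor_square s = range (tensor2 s)"

text \<open>
  Sweedler notation: a formal sum representing the tensor \<open>T\<close>.  It is only used below
  inside expressions that are multilinear in the components, so the choice does not matter.
\<close>

definition sw :: "'t list set \<Rightarrow> 't list" where
  "sw T = (SOME xs. xs \<in> T)"

definition tadd ::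
  "('f \<Rightarrow> 'k::ab_group_add \<Rightarrow> 'k) \<Rightarrow> ('k \<times> 'k) list set \<Rightarrow> ('k \<times> 'k) list set
     \<Rightarrow> ('k \<times> 'k) list set" where
  "tadd s X Y = tensor2 s (sw X @ sw Y)"

definition tscale ::
  "('f \<Rightarrow> 'k::ab_group_add \<Rightarrow> 'k) \<Rightarrow> 'f \<Rightarrow> ('k \<times> 'k) list set \<Rightarrow> ('k \<times> 'k) list set" where
  "tscale s c X = tensor2 s [(s c a, b). (a, b) \<leftarrow> sw X]"

definition tmult ::
  "('f \<Rightarrow> 'k::ring_1 \<Rightarrow> 'k) \<Rightarrow> ('k \<times> 'k) list set \<Rightarrow> ('k \<times> 'k) list set
     \<Rightarrow> ('k \<times> 'k) list set" where
  "tmult s X Y = tensor2 s [(a * c, b * d). (a, b) \<leftarrow> sw X, (c, d) \<leftarrow> sw Y]"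

definition tone :: "('f \<Rightarrow> 'k::ring_1 \<Rightarrow> 'k) \<Rightarrow> ('k \<times> 'k) list set" where
  "tone s = tensor2 s [(1, 1)]"

definition tflip ::
  "('f \<Rightarrow> 'k::ring_1 \<Rightarrow> 'k) \<Rightarrow> ('k \<times> 'k) list set \<Rightarrow> ('k \<times> 'k) list set" where
  "tflip s X = tensor2 s [(b, a). (a, b) \<leftarrow> sw X]"

definition is_tinverse ::
  "('f \<Rightarrow> 'k::ring_1 \<Rightarrow> 'k) \<Rightarrow> ('k \<times> 'k) list set \<Rightarrow> ('k \<times> 'k) list set \<Rightarrow> bool" where
  "is_tinverse s X Y \<longleftrightarrow> Y \<in> tensor_square s \<and> tmult s X Y = tone s \<and> tmult s Y X = tone s"

definition tinverse ::
  "('f \<Rightarrow> 'k::ring_1 \<Rightarrow> 'k) \<Rightarrow> ('k \<times> 'k) list set \<Rightarrow> ('k \<times> 'k) list set" where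
  "tinverse s X = (THE Y. is_tinverse s X Y)"

definition tmult3 ::
  "('f \<Rightarrow> 'k::ring_1 \<Rightarrow> 'k) \<Rightarrow> ('k \<times> 'k \<times> 'k) list set \<Rightarrow> ('k \<times> 'k \<times> 'k) list set
     \<Rightarrow> ('k \<times> 'k \<times> 'k) list set" where
  "tmult3 s X Y =
     tensor3 s [(a * a', b * b', d * d'). (a, b, d) \<leftarrow> sw X, (a', b', d') \<leftarrow> sw Y]"

definition leg12 ::
  "('f \<Rightarrow> 'k::ring_1 \<Rightarrow> 'k) \<Rightarrow> ('k \<times> 'k) list set \<Rightarrow> ('k \<times> 'k \<times> 'k) list set" where
  "leg12 s X = tensor3 s [(a, b, 1). (a, b) \<leftarrow> sw X]"

definition leg13 ::
  "('f \<Rightarrow> 'k::ring_1 \<Rightarrow> 'k) \<Rightarrow> ('k \<times> 'k) list set \<Rightarrow> ('k \<times> 'k \<times> 'k) list set" where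
  "leg13 s X = tensor3 s [(a, 1, b). (a, b) \<leftarrow> sw X]"

definition leg23 ::
  "('f \<Rightarrow> 'k::ring_1 \<Rightarrow> 'k) \<Rightarrow> ('k \<times> 'k) list set \<Rightarrow> ('k \<times> 'k \<times> 'k) list set" where
  "leg23 s X = tensor3 s [(1, a, b). (a, b) \<leftarrow> sw X]"

text \<open>The maps \<open>\<Delta> \<otimes> id\<close> and \<open>id \<otimes> \<Delta>\<close>.\<close>

definition comult_left ::
  "('f \<Rightarrow> 'k::ring_1 \<Rightarrow> 'k) \<Rightarrow> ('k \<Rightarrow> ('k \<times> 'k) list set) \<Rightarrow> ('k \<times> 'k) list set
     \<Rightarrow> ('k \<times> 'k \<times> 'k) list set" where
  "comult_left s \<Delta> X = tensor3 s [(a1, a2, b). (a, b) \<leftarrow> sw X, (a1, a2) \<leftarrow> sw (\<Delta> a)]"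

definition comult_right ::
  "('f \<Rightarrow> 'k::ring_1 \<Rightarrow> 'k) \<Rightarrow> ('k \<Rightarrow> ('k \<times> 'k) list set) \<Rightarrow> ('k \<times> 'k) list set
     \<Rightarrow> ('k \<times> 'k \<times> 'k) list set" where
  "comult_right s \<Delta> X = tensor3 s [(a, b1, b2). (a, b) \<leftarrow> sw X, (b1, b2) \<leftarrow> sw (\<Delta> b)]"


section \<open>Ribbon Hopf algebras\<close>

locale hopf_algebra =
  fixes s :: "'f::field \<Rightarrow> 'k::ring_1 \<Rightarrow> 'k"
    and \<Delta> :: "'k \<Rightarrow> ('k \<times> 'k) list set"
    and \<epsilon> :: "'k \<Rightarrow> 'f"
    and S :: "'k \<Rightarrow> 'k"
  assumes algebra: "algebra_on s UNIV (*) 1"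
    and comult_in: "\<Delta> h \<in> tensor_square s"
    and comult_add: "\<Delta> (h + k) = tadd s (\<Delta> h) (\<Delta> k)"
    and comult_scale: "\<Delta> (s c h) = tscale s c (\<Delta> h)"
    and coassoc: "comult_left s \<Delta> (\<Delta> h) = comult_right s \<Delta> (\<Delta> h)"
    and counit_linear: "Vector_Spaces.linear s (*) \<epsilon>"
    and counit_left: "(\<Sum>(h1, h2)\<leftarrow>sw (\<Delta> h). s (\<epsilon> h1) h2) = h"
    and counit_right: "(\<Sum>(h1, h2)\<leftarrow>sw (\<Delta> h). s (\<epsilon> h2) h1) = h"
    and comult_mult: "\<Delta> (h * k) = tmult s (\<Delta> h) (\<Delta> k)"
    and comult_one: "\<Delta> 1 = tone s"
    and counit_mult: "\<epsilon> (h * k) = \<epsilon> h * \<epsilon> k"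
    and counit_one: "\<epsilon> 1 = 1"
    and antipode_linear: "Vector_Spaces.linear s s S"
    and antipode_left: "(\<Sum>(h1, h2)\<leftarrow>sw (\<Delta> h). S h1 * h2) = s (\<epsilon> h) 1"
    and antipode_right: "(\<Sum>(h1, h2)\<leftarrow>sw (\<Delta> h). h1 * S h2) = s (\<epsilon> h) 1"

definition finite_dimensional :: "('f::field \<Rightarrow> 'k::ab_group_add \<Rightarrow> 'k) \<Rightarrow> bool" where
  "finite_dimensional s \<longleftrightarrow> (\<exists>B. finite_dimensional_vector_space s B)"

definition R_matrix ::
  "('f \<Rightarrow> 'k::ring_1 \<Rightarrow> 'k) \<Rightarrow> ('k \<Rightarrow> ('k \<times> 'k) list set) \<Rightarrow> ('k \<times> 'k) list set \<Rightarrow> bool" where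
  "R_matrix s \<Delta> R \<longleftrightarrow>
     R \<in> tensor_square s \<and> (\<exists>R'. is_tinverse s R R') \<and>
     (\<forall>h. tmult s R (\<Delta> h) = tmult s (tflip s (\<Delta> h)) R) \<and>
     comult_left s \<Delta> R = tmult3 s (leg13 s R) (leg23 s R) \<and>
     comult_right s \<Delta> R = tmult3 s (leg13 s R) (leg12 s R)"

definition drinfeld_element :: "('k::ring_1 \<Rightarrow> 'k) \<Rightarrow> ('k \<times> 'k) list set \<Rightarrow> 'k" where
  "drinfeld_element S R = (\<Sum>(a, b)\<leftarrow>sw R. S b * a)"

definition ribbon_element ::
  "('f::field \<Rightarrow> 'k::ring_1 \<Rightarrow> 'k) \<Rightarrow> ('k \<Rightarrow> ('k \<times> 'k) list set) \<Rightarrow> ('k \<Rightarrow> 'f) \<Rightarrow> ('k \<Rightarrow> 'k)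
     \<Rightarrow> ('k \<times> 'k) list set \<Rightarrow> 'k \<Rightarrow> bool" where
  "ribbon_element s \<Delta> \<epsilon> S R \<nu> \<longleftrightarrow>
     (\<forall>h. \<nu> * h = h * \<nu>) \<and> (\<exists>\<mu>. \<nu> * \<mu> = 1 \<and> \<mu> * \<nu> = 1) \<and>
     drinfeld_element S R * S (drinfeld_element S R) = \<nu>\<^sup>2 \<and>
     \<epsilon> \<nu> = 1 \<and> S \<nu> = \<nu> \<and>
     \<Delta> \<nu> = tmult s (tmult s (tinverse s R) (tinverse s (tflip s R))) (tensor2 s [(\<nu>, \<nu>)])"

definition ribbon_hopf_algebra ::
  "('f::field \<Rightarrow> 'k::ring_1 \<Rightarrow> 'k) \<Rightarrow> ('k \<Rightarrow> ('k \<times> 'k) list set) \<Rightarrow> ('k \<Rightarrow> 'f) \<Rightarrow> ('k \<Rightarrow> 'k)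
     \<Rightarrow> ('k \<times> 'k) list set \<Rightarrow> bool" where
  "ribbon_hopf_algebra s \<Delta> \<epsilon> S R \<longleftrightarrow>
     hopf_algebra s \<Delta> \<epsilon> S \<and> R_matrix s \<Delta> R \<and> (\<exists>\<nu>. ribbon_element s \<Delta> \<epsilon> S R \<nu>)"


section \<open>The dual Hopf algebra\<close>

definition dual :: "('f::field \<Rightarrow> 'k::ab_group_add \<Rightarrow> 'k) \<Rightarrow> ('k \<Rightarrow> 'f) set" where
  "dual s = {\<alpha>. Vector_Spaces.linear s (*) \<alpha>}"

definition dual_scale :: "'f::field \<Rightarrow> ('k \<Rightarrow> 'f) \<Rightarrow> 'k \<Rightarrow> 'f" where
  "dual_scale c \<alpha> = (\<lambda>h. c * \<alpha> h)"

text \<open>The pairing \<open>\<langle>\<alpha> \<otimes> \<beta>, X\<rangle>\<close>.\<close>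

definition pairing2 :: "('k \<Rightarrow> 'f::field) \<Rightarrow> ('k \<Rightarrow> 'f) \<Rightarrow> ('k \<times> 'k) list set \<Rightarrow> 'f" where
  "pairing2 \<alpha> \<beta> X = (\<Sum>(a, b)\<leftarrow>sw X. \<alpha> a * \<beta> b)"

definition dual_mult ::
  "('k \<Rightarrow> ('k \<times> 'k) list set) \<Rightarrow> ('k \<Rightarrow> 'f::field) \<Rightarrow> ('k \<Rightarrow> 'f) \<Rightarrow> 'k \<Rightarrow> 'f" where
  "dual_mult \<Delta> \<alpha> \<beta> = (\<lambda>h. pairing2 \<alpha> \<beta> (\<Delta> h))"

text \<open>
  The comultiplication of \<open>K\<^sup>*\<close> is the transpose of the product of \<open>K\<close>.  For finite-dimensional
  \<open>K\<close> a tensor in \<open>K\<^sup>* \<otimes> K\<^sup>*\<close> is determined by its values on \<open>K \<otimes> K\<close>, so the set of all formal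
  sums of pairs of functionals taking the value \<open>\<alpha> (h * k)\<close> at \<open>h \<otimes> k\<close> is exactly the class of
  formal sums representing the tensor \<open>\<alpha>\<^sub>(\<^sub>1\<^sub>) \<otimes> \<alpha>\<^sub>(\<^sub>2\<^sub>)\<close>.
\<close>

definition dual_comult ::
  "('f::field \<Rightarrow> 'k::ring_1 \<Rightarrow> 'k) \<Rightarrow> ('k \<Rightarrow> 'f) \<Rightarrow> (('k \<Rightarrow> 'f) \<times> ('k \<Rightarrow> 'f)) list set" where
  "dual_comult s \<alpha> =
     {xs. set xs \<subseteq> dual s \<times> dual s \<and> (\<forall>h k. (\<Sum>(\<alpha>1, \<alpha>2)\<leftarrow>xs. \<alpha>1 h * \<alpha>2 k) = \<alpha> (h * k))}"

text \<open>A formal sum representing \<open>\<alpha>\<^sub>(\<^sub>1\<^sub>) \<otimes> \<alpha>\<^sub>(\<^sub>2\<^sub>) \<otimes> \<alpha>\<^sub>(\<^sub>3\<^sub>)\<close>.\<close>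

definition dual_sw3 ::
  "('f::field \<Rightarrow> 'k::ring_1 \<Rightarrow> 'k) \<Rightarrow> ('k \<Rightarrow> 'f)
     \<Rightarrow> (('k \<Rightarrow> 'f) \<times> ('k \<Rightarrow> 'f) \<times> ('k \<Rightarrow> 'f)) list" where
  "dual_sw3 s \<alpha> =
     [(\<alpha>1, \<alpha>2, \<beta>). (\<gamma>, \<beta>) \<leftarrow> sw (dual_comult s \<alpha>), (\<alpha>1, \<alpha>2) \<leftarrow> sw (dual_comult s \<gamma>)]"

definition dual_antipode :: "('k \<Rightarrow> 'k) \<Rightarrow> ('k \<Rightarrow> 'f) \<Rightarrow> 'k \<Rightarrow> 'f" where
  "dual_antipode S \<alpha> = \<alpha> \<circ> S"

definition dual_antipode_inv ::
  "('f::field \<Rightarrow> 'k::ring_1 \<Rightarrow> 'k) \<Rightarrow> ('k \<Rightarrow> 'k) \<Rightarrow> ('k \<Rightarrow> 'f) \<Rightarrow> 'k \<Rightarrow> 'f" where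
  "dual_antipode_inv s S = inv_into (dual s) (dual_antipode S)"


section \<open>The twisted product on the dual and the Drinfeld map\<close>

text \<open>\<open>twisted_mult s \<Delta> S R \<beta> \<alpha>\<close> is \<open>\<beta> \<cdot>' \<alpha>\<close>.\<close>

definition twisted_mult ::
  "('f::field \<Rightarrow> 'k::ring_1 \<Rightarrow> 'k) \<Rightarrow> ('k \<Rightarrow> ('k \<times> 'k) list set) \<Rightarrow> ('k \<Rightarrow> 'k)
     \<Rightarrow> ('k \<times> 'k) list set \<Rightarrow> ('k \<Rightarrow> 'f) \<Rightarrow> ('k \<Rightarrow> 'f) \<Rightarrow> 'k \<Rightarrow> 'f" where
  "twisted_mult s \<Delta> S R \<beta> \<alpha> =
     (\<Sum>(\<alpha>1, \<alpha>2, \<alpha>3)\<leftarrow>dual_sw3 s \<alpha>. \<Sum>(\<beta>1, \<beta>2, \<beta>3)\<leftarrow>dual_sw3 s \<beta>.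
        dual_scale (pairing2 \<alpha>1 (dual_antipode S \<beta>3) R * pairing2 \<alpha>2 \<beta>1 R)
          (dual_mult \<Delta> \<alpha>3 \<beta>2))"

definition Q_element ::
  "('f \<Rightarrow> 'k::ring_1 \<Rightarrow> 'k) \<Rightarrow> ('k \<times> 'k) list set \<Rightarrow> ('k \<times> 'k) list set" where
  "Q_element s R = tmult s (tflip s R) R"

definition factorisable ::
  "('f::field \<Rightarrow> 'k::ring_1 \<Rightarrow> 'k) \<Rightarrow> ('k \<times> 'k) list set \<Rightarrow> bool" where
  "factorisable s R \<longleftrightarrow>
     linear_iso_on dual_scale (dual s) s UNIV (\<lambda>\<alpha>. \<Sum>(a, b)\<leftarrow>sw (Q_element s R). s (\<alpha> b) a)"

definition drinfeld_map ::
  "('f::field \<Rightarrow> 'k::ring_1 \<Rightarrow> 'k) \<Rightarrow> ('k \<Rightarrow> 'k) \<Rightarrow> ('k \<times> 'k) list set \<Rightarrow> ('k \<Rightarrow> 'f) \<Rightarrow> 'k" where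
  "drinfeld_map s S R \<alpha> = (\<Sum>(a, b)\<leftarrow>sw (Q_element s R). s (dual_antipode_inv s S \<alpha> a) b)"

end

theory Submission
  imports Defs
begin

text \<open>
  A single subscript of \<open>R\<close> or of \<open>Q = R\<^sub>2\<^sub>1 R\<close> denotes a Sweedler component, a double one the legs in
  which the tensor is placed; a prime marks another copy of the same tensor.  Write \<open>\<Phi>(\<alpha>) = Q\<^sub>1 \<langle>\<alpha>, Q\<^sub>2\<rangle>\<close> for the map whose bijectivity is
  factorisability.  The whole proposition reduces to \<open>\<Phi>\<close> by the identity \<open>D = S \<circ> \<Phi>\<close>: since
  \<open>(S \<otimes> S) R = R\<close>, the antihomomorphism \<open>S \<otimes> S\<close> sends \<open>Q = R\<^sub>2\<^sub>1 R\<close> to \<open>R R\<^sub>2\<^sub>1 = Q\<^sub>2\<^sub>1\<close>, so that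
  \<open>\<langle>\<alpha> \<circ> S\<inverse>, Q\<^sub>1\<rangle> Q\<^sub>2 = \<langle>\<alpha>, Q\<^sub>2\<rangle> S(Q\<^sub>1)\<close> (lemma \<open>drinfeld_map_eq\<close>).

  The antipode is bijective.  In any quasitriangular Hopf algebra \<open>S\<^sup>2(h) u = u h\<close>; the ribbon element
  makes \<open>u S(u) = \<nu>\<^sup>2\<close> invertible, hence \<open>u\<close> has a right inverse, which in finite dimension is
  two-sided, and \<open>S\<close> is injective (lemma \<open>bij_antipode\<close>).  Thus \<open>D\<close> is bijective exactly when \<open>\<Phi>\<close>
  is, and as \<open>S\<close> reverses products it remains to see that \<open>\<Phi>\<close> is an algebra homomorphism
  \<open>(K\<^sup>*, \<cdot>') \<rightarrow> K\<close>.

  Unfolding the coproducts of the dual gives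
  \<open>(\<beta> \<cdot>' \<alpha>)(h) = \<alpha>(R\<^sub>1 R'\<^sub>1 h\<^sub>1) \<beta>(R'\<^sub>2 h\<^sub>2 S(R\<^sub>2))\<close> (lemma \<open>twisted_mult_apply\<close>), so everything becomes
  an identity of tensors in \<open>K \<otimes> K \<otimes> K\<close>:

  \<^item> multiplicativity of \<open>\<Phi>\<close> is
    \<open>Q\<^sub>1 \<otimes> R\<^sub>1 R'\<^sub>1 Q\<^sub>2\<^sub>(\<^sub>1\<^sub>) \<otimes> R'\<^sub>2 Q\<^sub>2\<^sub>(\<^sub>2\<^sub>) S(R\<^sub>2) = Q'\<^sub>1 Q\<^sub>1 \<otimes> Q\<^sub>2 \<otimes> Q'\<^sub>2\<close>.  Here
    \<open>(id \<otimes> \<Delta>) Q = R\<^sub>2\<^sub>1 Q\<^sub>1\<^sub>3 R\<^sub>1\<^sub>2\<close>, the two factors \<open>R'\<^sub>2\<^sub>3\<close> and \<open>R\<^sub>2\<^sub>1\<close> fuse to a coproduct, which commutes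
    with \<open>Q\<^sub>1\<^sub>3\<close>, and afterwards the outer \<open>R\<close> cancels against \<open>R'\<close> because
    \<open>R\<^sub>1 R'\<^sub>1 \<otimes> R'\<^sub>2 S(R\<^sub>2) = 1 \<otimes> 1\<close> (lemma \<open>Q_transports_twisted_product\<close>);

  \<^item> associativity of \<open>\<cdot>'\<close> follows from the two hexagon identities, the intertwining property of \<open>R\<close>
    and the Yang--Baxter equation (lemma \<open>twisted_product_assoc\<close>); it needs its own proof because \<open>\<Phi>\<close>
    need not be injective.

  Tensors are equivalence classes of formal sums.  They are handled through the maps they can be
  paired with: two tensors are never compared directly, instead an identity is stated as the equality
  of the two Sweedler sums of an arbitrary balanced map.
\<close>

section \<open>Evaluating tensors on balanced maps\<close>

text \<open>
  A balanced map is a biadditive (triadditive) map that does not see in which leg a scalar is placed;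
  these are the maps into abelian groups that factor through the tensor product over the base field.
  The target carries no scalar multiplication, so the same rules serve maps into \<open>K\<close>, into the base
  field, and partial Sweedler sums.
\<close>

definition balanced2 ::
  "('f \<Rightarrow> 'k::ab_group_add \<Rightarrow> 'k) \<Rightarrow> ('k \<Rightarrow> 'k \<Rightarrow> 'v::ab_group_add) \<Rightarrow> bool" where
  "balanced2 s f \<longleftrightarrow>
     (\<forall>x x' y. f (x + x') y = f x y + f x' y) \<and>
     (\<forall>x y y'. f x (y + y') = f x y + f x y') \<and>
     (\<forall>c x y. f (s c x) y = f x (s c y))"

definition balanced3 ::
  "('f \<Rightarrow> 'k::ab_group_add \<Rightarrow> 'k) \<Rightarrow> ('k \<Rightarrow> 'k \<Rightarrow> 'k \<Rightarrow> 'v::ab_group_add) \<Rightarrow> bool" where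
  "balanced3 s f \<longleftrightarrow>
     (\<forall>x x' y z. f (x + x') y z = f x y z + f x' y z) \<and>
     (\<forall>x y y' z. f x (y + y') z = f x y z + f x y' z) \<and>
     (\<forall>x y z z'. f x y (z + z') = f x y z + f x y z') \<and>
     (\<forall>c x y z. f (s c x) y z = f x y (s c z)) \<and>
     (\<forall>c x y z. f x (s c y) z = f x y (s c z))"

text \<open>
  The equations are rewrite rules that move every scalar to the last argument.  Those for the other
  arguments are equations between functions because an inner Sweedler sum over the last leg
  eta-contracts \<open>f\<close>, and a fully applied left-hand side would not match it.
\<close>

lemma balanced2_rules:
  assumes "balanced2 s f"
  shows "f (x + x') = (\<lambda>y. f x y + f x' y)"
    and "f x (y + y') = f x y + f x y'"
    and "f (s c x) = (\<lambda>y. f x (s c y))"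
  using assms by (simp_all add: balanced2_def fun_eq_iff)

lemma balanced3_rules:
  assumes "balanced3 s f"
  shows "f (x + x') = (\<lambda>y z. f x y z + f x' y z)"
    and "f x (y + y') = (\<lambda>z. f x y z + f x y' z)"
    and "f x y (z + z') = f x y z + f x y z'"
    and "f (s c x) = (\<lambda>y z. f x y (s c z))"
    and "f x (s c y) = (\<lambda>z. f x y (s c z))"
  using assms by (simp_all add: balanced3_def fun_eq_iff)

text \<open>
  \<open>tsum X f\<close> is \<open>f(X\<^sub>1, X\<^sub>2)\<close> in Sweedler notation, the value at \<open>X\<close> of the map on the tensor product
  induced by \<open>f\<close>.
\<close>

definition tsum :: "('k \<times> 'k) list set \<Rightarrow> ('k \<Rightarrow> 'k \<Rightarrow> 'v::ab_group_add) \<Rightarrow> 'v" where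
  "tsum X f = (\<Sum>(a, b)\<leftarrow>sw X. f a b)"

definition tsum3 ::
  "('k \<times> 'k \<times> 'k) list set \<Rightarrow> ('k \<Rightarrow> 'k \<Rightarrow> 'k \<Rightarrow> 'v::ab_group_add) \<Rightarrow> 'v" where
  "tsum3 X f = (\<Sum>(a, b, d)\<leftarrow>sw X. f a b d)"

lemma formal_sum_cong_sum_list:
  fixes g :: "'t \<Rightarrow> 'v::ab_group_add"
  assumes "formal_sum_cong G xs ys"
    and "\<And>xs ys. G xs ys \<Longrightarrow> sum_list (map g xs) = sum_list (map g ys)"
  shows "sum_list (map g xs) = sum_list (map g ys)"
  using assms(1) by induction (simp_all add: assms(2) add.commute)

text \<open>
  The universal property of the tensor product: the Sweedler sum of a balanced map depends only on the
  class of the formal sum.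
\<close>

lemma balanced2_sum_list:
  assumes "formal_sum_cong (bilinear_rel s) xs ys" and f: "balanced2 s f"
  shows "(\<Sum>(a, b)\<leftarrow>xs. f a b) = (\<Sum>(a, b)\<leftarrow>ys. f a b)"
proof (rule formal_sum_cong_sum_list[OF assms(1)])
  have z: "f 0 y = 0" for y
    using f unfolding balanced2_def by (metis add_cancel_right_right)
  fix xs ys
  assume "bilinear_rel s xs ys"
  then show "(\<Sum>(a, b)\<leftarrow>xs. f a b) = (\<Sum>(a, b)\<leftarrow>ys. f a b)"
    using f by cases (auto simp: balanced2_def z)
qed

lemma balanced3_sum_list:
  assumes "formal_sum_cong (trilinear_rel s) xs ys" and f: "balanced3 s f"
  shows "(\<Sum>(a, b, d)\<leftarrow>xs. f a b d) = (\<Sum>(a, b, d)\<leftarrow>ys. f a b d)"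
proof (rule formal_sum_cong_sum_list[OF assms(1)])
  have z: "f 0 y w = 0" for y w
    using f unfolding balanced3_def by (metis add_cancel_right_right)
  fix xs ys
  assume "trilinear_rel s xs ys"
  then show "(\<Sum>(a, b, d)\<leftarrow>xs. f a b d) = (\<Sum>(a, b, d)\<leftarrow>ys. f a b d)"
    using f by cases (auto simp: balanced3_def z)
qed

lemma tsum_tensor2:
  assumes "balanced2 s f"
  shows "tsum (tensor2 s xs) f = (\<Sum>(a, b)\<leftarrow>xs. f a b)"
proof -
  have "formal_sum_cong (bilinear_rel s) xs (sw (tensor2 s xs))"
    unfolding sw_def tensor2_def by (metis formal_sum_cong.refl mem_Collect_eq someI_ex)
  then show ?thesis
    unfolding tsum_def using balanced2_sum_list[OF _ assms] by metis
qed

lemma tsum3_tensor3: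
  assumes "balanced3 s f"
  shows "tsum3 (tensor3 s xs) f = (\<Sum>(a, b, d)\<leftarrow>xs. f a b d)"
proof -
  have "formal_sum_cong (trilinear_rel s) xs (sw (tensor3 s xs))"
    unfolding sw_def tensor3_def by (metis formal_sum_cong.refl mem_Collect_eq someI_ex)
  then show ?thesis
    unfolding tsum3_def using balanced3_sum_list[OF _ assms] by metis
qed

lemma sum_list_map_concat:
  "sum_list (map g (concat (map h xs))) = (\<Sum>x\<leftarrow>xs. sum_list (map g (h x)))"
  by (induction xs) auto

lemma tsum_add: "tsum X (\<lambda>a b. f a b + g a b) = tsum X f + tsum X g"
  unfolding tsum_def by (simp add: sum_list_addf[symmetric] case_prod_unfold)

lemma tsum_swap:
  "tsum X (\<lambda>a b. tsum Y (\<lambda>c d. f a b c d)) = tsum Y (\<lambda>c d. tsum X (\<lambda>a b. f a b c d))"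
proof -
  have "(\<Sum>x\<leftarrow>xs. \<Sum>y\<leftarrow>ys. F x y) = (\<Sum>y\<leftarrow>ys. \<Sum>x\<leftarrow>xs. (F x y :: 'a))"
    for xs :: "('b \<times> 'b) list" and ys :: "('c \<times> 'c) list" and F
    by (induction xs) (auto simp: sum_list_addf)
  then show ?thesis
    unfolding tsum_def by (simp add: case_prod_unfold)
qed

text \<open>
  Blockwise exchanges of independent Sweedler sums.  They are applied as single steps because sums over
  several copies of the same \<open>R\<close> cannot be brought into a canonical order by rewriting with
  commutation.
\<close>

lemma tsum_rotate:
  "tsum X (\<lambda>a b. tsum Y (\<lambda>c d. tsum Z (\<lambda>e g. f a b c d e g))) =
   tsum Y (\<lambda>c d. tsum Z (\<lambda>e g. tsum X (\<lambda>a b. f a b c d e g)))"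
  by (subst tsum_swap) (simp only: tsum_swap[of X Z])

lemma tsum_swap_pairs:
  "tsum X (\<lambda>a b. tsum X' (\<lambda>a' b'. tsum Y (\<lambda>c d. tsum Y' (\<lambda>c' d'. f a b a' b' c d c' d')))) =
   tsum Y (\<lambda>c d. tsum Y' (\<lambda>c' d'. tsum X (\<lambda>a b. tsum X' (\<lambda>a' b'. f a b a' b' c d c' d'))))"
  by (simp only: tsum_rotate[of X' Y Y']) (rule tsum_rotate)

lemma tsum_cong: "(\<And>a b. f a b = g a b) \<Longrightarrow> tsum X f = tsum X g"
  by presburger

lemma tsum_additive:
  assumes "\<And>x y. g (x + y) = g x + g y"
  shows "g (tsum X f) = tsum X (\<lambda>a b. g (f a b))"
proof -
  have "g 0 = 0" using assms[of 0 0] by simp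
  then have "g (sum_list xs) = sum_list (map g xs)" for xs
    by (induction xs) (auto simp: assms)
  then show ?thesis
    unfolding tsum_def by (simp add: comp_def case_prod_unfold)
qed

lemma tsum_left_distrib: "(y::'v::ring) * tsum X f = tsum X (\<lambda>a b. y * f a b)"
  by (rule tsum_additive) (simp add: distrib_left)

lemma tsum_right_distrib: "tsum X f * (y::'v::ring) = tsum X (\<lambda>a b. f a b * y)"
  by (rule tsum_additive[where g = "\<lambda>x. x * y"]) (simp add: distrib_right)

lemma tsum_tadd:
  "balanced2 s f \<Longrightarrow> tsum (tadd s X Y) f = tsum X f + tsum Y f"
  unfolding tadd_def by (simp add: tsum_tensor2) (simp add: tsum_def)

lemma tsum_tscale:
  "balanced2 s f \<Longrightarrow> tsum (tscale s c X) f = tsum X (\<lambda>a b. f (s c a) b)"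
  unfolding tscale_def by (simp add: tsum_tensor2) (simp add: tsum_def comp_def case_prod_unfold)

lemma tsum_tmult:
  "balanced2 s f \<Longrightarrow> tsum (tmult s X Y) f = tsum X (\<lambda>a b. tsum Y (\<lambda>c d. f (a * c) (b * d)))"
  unfolding tmult_def
  by (simp add: tsum_tensor2)
     (simp add: tsum_def sum_list_map_concat comp_def case_prod_unfold)

lemma tsum_tone: "balanced2 s f \<Longrightarrow> tsum (tone s) f = f 1 1"
  unfolding tone_def by (simp add: tsum_tensor2)

lemma tsum_tflip: "balanced2 s f \<Longrightarrow> tsum (tflip s X) f = tsum X (\<lambda>a b. f b a)"
  unfolding tflip_def by (simp add: tsum_tensor2) (simp add: tsum_def comp_def case_prod_unfold)


lemma tsum3_comult_left:
  "balanced3 s f \<Longrightarrow>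
     tsum3 (comult_left s \<Delta> X) f = tsum X (\<lambda>a b. tsum (\<Delta> a) (\<lambda>a1 a2. f a1 a2 b))"
  unfolding comult_left_def
  by (simp add: tsum3_tensor3)
     (simp add: tsum_def sum_list_map_concat comp_def case_prod_unfold)

lemma tsum3_comult_right:
  "balanced3 s f \<Longrightarrow>
     tsum3 (comult_right s \<Delta> X) f = tsum X (\<lambda>a b. tsum (\<Delta> b) (\<lambda>b1 b2. f a b1 b2))"
  unfolding comult_right_def
  by (simp add: tsum3_tensor3)
     (simp add: tsum_def sum_list_map_concat comp_def case_prod_unfold)

lemma tsum3_tmult3:
  "balanced3 s f \<Longrightarrow>
     tsum3 (tmult3 s X Y) f =
       tsum3 X (\<lambda>a b d. tsum3 Y (\<lambda>a' b' d'. f (a * a') (b * b') (d * d')))"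
  unfolding tmult3_def
  by (simp add: tsum3_tensor3)
     (simp add: tsum3_def sum_list_map_concat comp_def case_prod_unfold)

lemma tsum3_leg:
  assumes "balanced3 s f"
  shows "tsum3 (leg12 s X) f = tsum X (\<lambda>a b. f a b 1)"
    and "tsum3 (leg13 s X) f = tsum X (\<lambda>a b. f a 1 b)"
    and "tsum3 (leg23 s X) f = tsum X (\<lambda>a b. f 1 a b)"
  unfolding leg12_def leg13_def leg23_def
  by (simp_all add: tsum3_tensor3 assms) (simp_all add: tsum_def comp_def case_prod_unfold)

section \<open>Sweedler calculus in a Hopf algebra\<close>

context hopf_algebra
begin

lemma vector_space: "vector_space s"
  using algebra by (simp add: algebra_on_def)

lemma scale_mult [simp]: "s c x * y = s c (x * y)" "x * s c y = s c (x * y)"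
  using algebra by (simp_all add: algebra_on_def)

lemma scale_add: "s c (x + y) = s c x + s c y" "s (c + d) x = s c x + s d x"
  using vector_space by (simp_all add: vector_space_def)

lemma scale_scale [simp]: "s c (s d x) = s (c * d) x" "s 1 x = x"
  using vector_space by (simp_all add: vector_space_def)

lemma antipode_add: "S (x + y) = S x + S y" and antipode_scale: "S (s c x) = s c (S x)"
  using antipode_linear by (simp_all add: Vector_Spaces.linear_iff)

lemma counit_add: "\<epsilon> (x + y) = \<epsilon> x + \<epsilon> y" and counit_scale: "\<epsilon> (s c x) = c * \<epsilon> x"
  using counit_linear by (simp_all add: Vector_Spaces.linear_iff)

lemma tsum_comult_add: "balanced2 s f \<Longrightarrow> tsum (\<Delta> (x + y)) f = tsum (\<Delta> x) f + tsum (\<Delta> y) f"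
  by (simp add: comult_add tsum_tadd)

lemma tsum_comult_scale:
  "balanced2 s f \<Longrightarrow> tsum (\<Delta> (s c x)) f = tsum (\<Delta> x) (\<lambda>a b. f (s c a) b)"
  by (simp add: comult_scale tsum_tscale)

lemma tsum_scale: "s c (tsum X f) = tsum X (\<lambda>a b. s c (f a b))"
  by (rule tsum_additive) (rule scale_add)

text \<open>
  These rules decide that an expression built from products, antipodes and nested Sweedler sums is
  balanced in the variables that occur in it once.
\<close>

lemmas multilinear_simps =
  balanced2_def balanced3_def scale_add antipode_add antipode_scale counit_add counit_scale
  distrib_left distrib_right tsum_add tsum_comult_add tsum_comult_scale mult.commute

lemma tsum_comult_mult:
  "balanced2 s f \<Longrightarrow>
     tsum (\<Delta> (x * y)) f = tsum (\<Delta> x) (\<lambda>a b. tsum (\<Delta> y) (\<lambda>c d. f (a * c) (b * d)))"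
  by (simp add: comult_mult tsum_tmult)

lemma tsum_comult_one: "balanced2 s f \<Longrightarrow> tsum (\<Delta> 1) f = f 1 1"
  by (simp add: comult_one tsum_tone)

lemma tsum_coassoc:
  assumes "balanced3 s f"
  shows "tsum (\<Delta> h) (\<lambda>a b. tsum (\<Delta> a) (\<lambda>a1 a2. f a1 a2 b)) =
         tsum (\<Delta> h) (\<lambda>a b. tsum (\<Delta> b) (\<lambda>b1 b2. f a b1 b2))"
  using assms coassoc[of h]
  by (simp flip: tsum3_comult_left tsum3_comult_right)

lemma tsum_counit_left: "tsum (\<Delta> h) (\<lambda>a b. s (\<epsilon> a) b) = h"
  and tsum_counit_right: "tsum (\<Delta> h) (\<lambda>a b. s (\<epsilon> b) a) = h"
  and tsum_antipode_left: "tsum (\<Delta> h) (\<lambda>a b. S a * b) = s (\<epsilon> h) 1"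
  and tsum_antipode_right: "tsum (\<Delta> h) (\<lambda>a b. a * S b) = s (\<epsilon> h) 1"
  unfolding tsum_def by (fact counit_left counit_right antipode_left antipode_right)+

text \<open>
  The cancellation \<open>h\<^sub>1 \<otimes> h\<^sub>2 S(h\<^sub>3) = h \<otimes> 1\<close> and its variants on the other side: the antipode axiom leaves
  \<open>\<epsilon>\<close> on one leg, and the counit axiom absorbs it into the other.
\<close>

lemma antipode_cancel:
  assumes f: "balanced2 s f"
  shows antipode_cancel_right_id: "tsum (\<Delta> h) (\<lambda>a b. tsum (\<Delta> b) (\<lambda>x y. f a (x * S y))) = f h 1"
    and antipode_cancel_left_id: "tsum (\<Delta> h) (\<lambda>a b. tsum (\<Delta> a) (\<lambda>x y. f (x * S y) b)) = f 1 h"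
    and antipode_cancel_left_S: "tsum (\<Delta> h) (\<lambda>a b. tsum (\<Delta> a) (\<lambda>x y. f (S x * y) b)) = f 1 h"
proof -
  have add: "f (x + x') y = f x y + f x' y" "f x (y + y') = f x y + f x y'"
    and scale: "f (s c x) y = f x (s c y)" for c x x' y y'
    using f by (simp_all add: balanced2_def)
  have right: "tsum (\<Delta> h) (\<lambda>a b. f a (s (\<epsilon> b) 1)) = f h 1"
    using tsum_additive[of "\<lambda>x. f x 1" "\<Delta> h" "\<lambda>a b. s (\<epsilon> b) a"]
    by (simp add: add scale tsum_counit_right)
  have left: "tsum (\<Delta> h) (\<lambda>a b. f (s (\<epsilon> a) 1) b) = f 1 h"
    using tsum_additive[of "f 1" "\<Delta> h" "\<lambda>a b. s (\<epsilon> a) b"]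
    by (simp add: add scale tsum_counit_left)
  have pull: "tsum X (\<lambda>x y. f a (g x y)) = f a (tsum X g)" "tsum X (\<lambda>x y. f (g x y) b) = f (tsum X g) b"
    for X a b and g :: "'k \<Rightarrow> 'k \<Rightarrow> 'k"
    using tsum_additive[of "f a" X g] tsum_additive[of "\<lambda>u. f u b" X g] by (simp_all add: add)
  show "tsum (\<Delta> h) (\<lambda>a b. tsum (\<Delta> b) (\<lambda>x y. f a (x * S y))) = f h 1"
    by (simp add: pull right tsum_antipode_right)
  show "tsum (\<Delta> h) (\<lambda>a b. tsum (\<Delta> a) (\<lambda>x y. f (x * S y) b)) = f 1 h"
    by (simp add: pull left tsum_antipode_right)
  show "tsum (\<Delta> h) (\<lambda>a b. tsum (\<Delta> a) (\<lambda>x y. f (S x * y) b)) = f 1 h"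
    by (simp add: pull left tsum_antipode_left)
qed

section \<open>The antipode as an antihomomorphism\<close>

lemma antipode_one: "S 1 = 1"
proof -
  have "balanced2 s (\<lambda>a b. S a * b)" by (simp add: multilinear_simps)
  from tsum_comult_one[OF this] show ?thesis
    by (simp add: tsum_antipode_left counit_one)
qed

text \<open>
  Both \<open>S(xy)\<close> and \<open>S(y) S(x)\<close> are convolution inverse to the multiplication \<open>K \<otimes> K \<rightarrow> K\<close>.  Evaluating
  \<open>S(x\<^sub>1 y\<^sub>1) x\<^sub>2 y\<^sub>2 S(y\<^sub>3) S(x\<^sub>3)\<close> with the two possible bracketings therefore gives one or the other.
\<close>

lemma antipode_mult: "S (x * y) = S y * S x"
proof -
  let ?G = "\<lambda>a b e c d g. S (a * c) * (b * (d * S g) * S e)"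
  have S_counit: "tsum (\<Delta> h) (\<lambda>a b. S (s (\<epsilon> a) b)) = S h" for h
    using tsum_additive[of S, OF antipode_add] tsum_counit_left by metis
  have "S (x * y) = tsum (\<Delta> x) (\<lambda>a b. tsum (\<Delta> b) (\<lambda>b1 b2. S (a * y) * (b1 * S b2)))"
    by (subst antipode_cancel_right_id[where f = "\<lambda>u v. S (u * y) * v"])
       (simp_all add: multilinear_simps)
  also have "\<dots> = tsum (\<Delta> x) (\<lambda>a b. tsum (\<Delta> b) (\<lambda>b1 b2.
                   tsum (\<Delta> y) (\<lambda>c d. tsum (\<Delta> d) (\<lambda>d1 d2. ?G a b1 b2 c d1 d2))))"
    by (subst antipode_cancel_right_id[where f = "\<lambda>u v. S (a * u) * (b1 * v * S b2)" for a b1 b2])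
       (simp_all add: multilinear_simps)
  also have "\<dots> = tsum (\<Delta> x) (\<lambda>a b. tsum (\<Delta> b) (\<lambda>b1 b2.
                   tsum (\<Delta> y) (\<lambda>c d. tsum (\<Delta> c) (\<lambda>c1 c2. ?G a b1 b2 c1 c2 d))))"
    by (subst tsum_coassoc) (simp_all add: multilinear_simps)
  also have "\<dots> = tsum (\<Delta> x) (\<lambda>a b. tsum (\<Delta> a) (\<lambda>a1 a2.
                   tsum (\<Delta> y) (\<lambda>c d. tsum (\<Delta> c) (\<lambda>c1 c2. ?G a1 a2 b c1 c2 d))))"
    by (subst tsum_coassoc[symmetric]) (simp_all add: multilinear_simps)
  also have "\<dots> = tsum (\<Delta> x) (\<lambda>a b. tsum (\<Delta> y) (\<lambda>c d.
                   tsum (\<Delta> (a * c)) (\<lambda>u v. S u * v) * (S d * S b)))"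
    by (subst tsum_comult_mult) (simp_all add: multilinear_simps mult.assoc tsum_swap[of "\<Delta> y"] tsum_right_distrib)
  also have "\<dots> = tsum (\<Delta> x) (\<lambda>a b. tsum (\<Delta> y) (\<lambda>c d. S (s (\<epsilon> c) d) * S (s (\<epsilon> a) b)))"
    by (simp add: tsum_antipode_left counit_mult antipode_scale)
  also have "\<dots> = tsum (\<Delta> y) (\<lambda>c d. S (s (\<epsilon> c) d)) * tsum (\<Delta> x) (\<lambda>a b. S (s (\<epsilon> a) b))"
    by (simp only: tsum_right_distrib tsum_left_distrib tsum_swap[of "\<Delta> x"])
  also have "\<dots> = S y * S x"
    by (simp add: S_counit)
  finally show ?thesis .
qed

text \<open>
  \<open>\<Delta>(S(h)) = S(h\<^sub>2) \<otimes> S(h\<^sub>1)\<close>, again by uniqueness of convolution inverses, now of \<open>\<Delta> : K \<rightarrow> K \<otimes> K\<close>: the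
  two bracketings of \<open>\<Delta>(S(h\<^sub>1)) (h\<^sub>2 \<otimes> h\<^sub>3) (S(h\<^sub>5) \<otimes> S(h\<^sub>4))\<close> are compared.
\<close>

lemma tsum_comult_antipode:
  assumes f: "balanced2 s f"
  shows "tsum (\<Delta> (S h)) f = tsum (\<Delta> h) (\<lambda>a b. f (S b) (S a))"
proof -
  note [simp] = balanced2_rules[OF f]
  let ?G = "\<lambda>p q x y z w. f (p * (x * S w)) (q * (y * S z))"
  have "tsum (\<Delta> (S h)) f =
      tsum (\<Delta> h) (\<lambda>a b. tsum (\<Delta> b) (\<lambda>x t. tsum (\<Delta> (S a)) (\<lambda>p q. f (p * (x * S t)) q)))"
    by (subst antipode_cancel_right_id[where f = "\<lambda>u v. tsum (\<Delta> (S u)) (\<lambda>p q. f (p * v) q)"])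
       (simp_all add: multilinear_simps)
  also have "\<dots> = tsum (\<Delta> h) (\<lambda>a b. tsum (\<Delta> b) (\<lambda>x t. tsum (\<Delta> (S a)) (\<lambda>p q.
                   tsum (\<Delta> t) (\<lambda>t1 w. tsum (\<Delta> t1) (\<lambda>y z. ?G p q x y z w)))))"
    by (subst antipode_cancel_left_id[where f = "\<lambda>u w. f (p * (x * S w)) (q * u)" for p q x])
       (simp_all add: multilinear_simps)
  also have "\<dots> = tsum (\<Delta> h) (\<lambda>a b. tsum (\<Delta> b) (\<lambda>x t. tsum (\<Delta> t) (\<lambda>y t'.
                   tsum (\<Delta> (S a)) (\<lambda>p q. tsum (\<Delta> t') (\<lambda>z w. ?G p q x y z w)))))"
    by (subst tsum_coassoc) (simp_all add: multilinear_simps tsum_swap[of "\<Delta> (S a)" for a])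
  also have "\<dots> = tsum (\<Delta> h) (\<lambda>a b. tsum (\<Delta> b) (\<lambda>b1 b2. tsum (\<Delta> b1) (\<lambda>x y.
                   tsum (\<Delta> (S a)) (\<lambda>p q. tsum (\<Delta> b2) (\<lambda>z w. ?G p q x y z w)))))"
    by (subst tsum_coassoc[symmetric]) (simp_all add: multilinear_simps)
  also have "\<dots> = tsum (\<Delta> h) (\<lambda>a b. tsum (\<Delta> a) (\<lambda>a1 a2. tsum (\<Delta> a2) (\<lambda>x y.
                   tsum (\<Delta> (S a1)) (\<lambda>p q. tsum (\<Delta> b) (\<lambda>z w. ?G p q x y z w)))))"
    by (subst tsum_coassoc[symmetric]) (simp_all add: multilinear_simps)
  also have "\<dots> = tsum (\<Delta> h) (\<lambda>a b. tsum (\<Delta> a) (\<lambda>a1 a2.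
                   tsum (\<Delta> (S a1 * a2)) (\<lambda>u v. tsum (\<Delta> b) (\<lambda>z w. f (u * S w) (v * S z)))))"
    by (subst tsum_comult_mult)
       (simp_all add: multilinear_simps mult.assoc tsum_swap[of "\<Delta> (S a)" for a])
  also have "\<dots> = tsum (\<Delta> h) (\<lambda>a b. f (S b) (S a))"
    by (subst antipode_cancel_left_S[where f = "\<lambda>u b. tsum (\<Delta> u) (\<lambda>u v. tsum (\<Delta> b) (\<lambda>z w. f (u * S w) (v * S z)))"])
       (simp_all add: multilinear_simps tsum_comult_one)
  finally show ?thesis .
qed

lemma counit_antipode: "\<epsilon> (S h) = \<epsilon> h"
proof -
  have add: "\<epsilon> (S (x + y)) = \<epsilon> (S x) + \<epsilon> (S y)" for x y
    by (simp add: multilinear_simps)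
  have "\<epsilon> (S h) = tsum (\<Delta> h) (\<lambda>a b. \<epsilon> (S (s (\<epsilon> b) a)))"
    using tsum_additive[of "\<lambda>x. \<epsilon> (S x)", OF add] tsum_counit_right[of h] by metis
  also have "\<dots> = tsum (\<Delta> h) (\<lambda>a b. \<epsilon> (S a * b))"
    by (simp add: counit_mult antipode_scale counit_scale mult.commute)
  also have "\<dots> = \<epsilon> (tsum (\<Delta> h) (\<lambda>a b. S a * b))"
    by (rule tsum_additive[symmetric]) (rule counit_add)
  also have "\<dots> = \<epsilon> h"
    by (simp add: tsum_antipode_left counit_scale counit_one)
  finally show ?thesis .
qed

section \<open>The dual and the twisted product\<close>

lemma dual_iff:
  "\<alpha> \<in> dual s \<longleftrightarrow> (\<forall>x y. \<alpha> (x + y) = \<alpha> x + \<alpha> y) \<and> (\<forall>c x. \<alpha> (s c x) = c * \<alpha> x)"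
  using vector_space counit_linear by (simp add: dual_def Vector_Spaces.linear_iff)

lemma counit_in_dual: "\<epsilon> \<in> dual s"
  by (simp add: dual_def counit_linear)

text \<open>
  Finite dimension enters here: with a basis \<open>b\<close> and its coordinate functionals \<open>b\<^sup>*\<close>, the coproduct of
  \<open>\<alpha>\<close> is the finite sum of the \<open>b\<^sup>* \<otimes> \<alpha>(b _)\<close>.  Without a representing formal sum the choice made in
  \<open>sw\<close> would be arbitrary.
\<close>

lemma dual_comult_nonempty:
  assumes fin: "finite_dimensional s" and \<alpha>: "\<alpha> \<in> dual s"
  shows "\<exists>xs. xs \<in> dual_comult s \<alpha>"
proof -
  obtain B where "finite_dimensional_vector_space s B"
    using fin by (auto simp: finite_dimensional_def)
  then interpret fd: finite_dimensional_vector_space s B .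
  obtain bs where bs: "set bs = B" "distinct bs"
    using finite_distinct_list[OF fd.finite_Basis] by auto
  define coord where "coord b = (\<lambda>h. fd.representation B h b)" for b
  have coord: "coord b \<in> dual s" for b
    using fd.representation_add[OF fd.independent_Basis] fd.representation_scale[OF fd.independent_Basis]
    by (simp add: dual_iff coord_def fd.span_Basis)
  have expand: "h = (\<Sum>b\<leftarrow>bs. s (coord b h) b)" for h
    using fd.sum_representation_eq[OF fd.independent_Basis, of h B] bs
    by (simp add: sum_list_distinct_conv_sum_set coord_def fd.span_Basis fd.finite_Basis)
  have \<alpha>_sum_list: "\<alpha> (sum_list xs * k) = (\<Sum>x\<leftarrow>xs. \<alpha> (x * k))" for xs k
  proof (induction xs)
    case Nil
    have "\<alpha> 0 = 0"
      using \<alpha> unfolding dual_iff by (metis add.right_neutral add_cancel_right_right)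
    then show ?case by simp
  qed (use \<alpha> in \<open>simp add: dual_iff distrib_right\<close>)
  have "(\<Sum>b\<leftarrow>bs. coord b h * \<alpha> (b * k)) = \<alpha> (h * k)" for h k
    using \<alpha>_sum_list[of "map (\<lambda>b. s (coord b h) b) bs" k] \<alpha>
    by (simp add: dual_iff comp_def flip: expand)
  moreover have "(\<lambda>k. \<alpha> (b * k)) \<in> dual s" for b
    using \<alpha> by (simp add: dual_iff distrib_left)
  ultimately have "map (\<lambda>b. (coord b, \<lambda>k. \<alpha> (b * k))) bs \<in> dual_comult s \<alpha>"
    using coord by (auto simp: dual_comult_def comp_def)
  then show ?thesis ..
qed

lemma sum_list_dual_sw3:
  assumes fin: "finite_dimensional s" and \<alpha>: "\<alpha> \<in> dual s"
  shows "(\<Sum>(\<alpha>1, \<alpha>2, \<alpha>3)\<leftarrow>dual_sw3 s \<alpha>. \<alpha>1 x * \<alpha>2 y * \<alpha>3 z) = \<alpha> (x * y * z)"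
proof -
  have sw: "sw (dual_comult s \<gamma>) \<in> dual_comult s \<gamma>" if "\<gamma> \<in> dual s" for \<gamma>
    unfolding sw_def using dual_comult_nonempty[OF fin that] by (rule someI_ex)
  have inner: "(\<Sum>(\<alpha>1, \<alpha>2)\<leftarrow>sw (dual_comult s \<gamma>). \<alpha>1 x * \<alpha>2 y * c) = \<gamma> (x * y) * c"
    if "\<gamma> \<in> dual s" for \<gamma> c
    using sw[OF that] sum_list_mult_const[of "\<lambda>(\<alpha>1, \<alpha>2). \<alpha>1 x * \<alpha>2 y" c]
    by (simp add: dual_comult_def case_prod_unfold)
  have "(\<Sum>(\<alpha>1, \<alpha>2, \<alpha>3)\<leftarrow>dual_sw3 s \<alpha>. \<alpha>1 x * \<alpha>2 y * \<alpha>3 z) =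
      (\<Sum>(\<gamma>, \<beta>)\<leftarrow>sw (dual_comult s \<alpha>). \<Sum>(\<alpha>1, \<alpha>2)\<leftarrow>sw (dual_comult s \<gamma>). \<alpha>1 x * \<alpha>2 y * \<beta> z)"
    unfolding dual_sw3_def by (simp add: sum_list_map_concat comp_def case_prod_unfold)
  also have "\<dots> = (\<Sum>(\<gamma>, \<beta>)\<leftarrow>sw (dual_comult s \<alpha>). \<gamma> (x * y) * \<beta> z)"
    using sw[OF \<alpha>] inner
    by (intro arg_cong[where f = sum_list] map_cong) (auto simp: dual_comult_def)
  also have "\<dots> = \<alpha> (x * y * z)"
    using sw[OF \<alpha>] by (simp add: dual_comult_def)
  finally show ?thesis .
qed

text \<open>
  The formula through which the twisted product is used from now on:
  \<open>(\<beta> \<cdot>' \<alpha>)(h) = \<alpha>(R\<^sub>1 R'\<^sub>1 h\<^sub>1) \<beta>(R'\<^sub>2 h\<^sub>2 S(R\<^sub>2))\<close>.  Evaluation turns the threefold coproduct of a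
  functional into a product of three arguments.
\<close>

lemma twisted_mult_apply:
  assumes fin: "finite_dimensional s" and \<alpha>: "\<alpha> \<in> dual s" and \<beta>: "\<beta> \<in> dual s"
  shows "twisted_mult s \<Delta> S R \<beta> \<alpha> h =
    tsum R (\<lambda>a b. tsum R (\<lambda>c d. tsum (\<Delta> h) (\<lambda>x y. \<alpha> (a * c * x) * \<beta> (d * y * S b))))"
proof -
  have apply_sum: "sum_list (map F zs) h = (\<Sum>z\<leftarrow>zs. F z h)" for F :: "'z \<Rightarrow> 'k \<Rightarrow> 'f" and zs
    by (induction zs) auto
  have pull: "(\<Sum>z\<leftarrow>zs. tsum X (F z)) = tsum X (\<lambda>a b. \<Sum>z\<leftarrow>zs. F z a b)"
    for X and F :: "'z \<Rightarrow> 'k \<Rightarrow> 'k \<Rightarrow> 'f" and zs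
    by (induction zs) (simp_all add: tsum_add, simp add: tsum_def case_prod_unfold)
  have split: "(\<Sum>z\<leftarrow>zs. \<Sum>w\<leftarrow>ws. F z * G w) = (\<Sum>z\<leftarrow>zs. F z) * (\<Sum>w\<leftarrow>ws. G w)"
    for F :: "'z \<Rightarrow> 'f" and G :: "'w \<Rightarrow> 'f" and zs ws
    by (simp add: sum_list_const_mult sum_list_mult_const)
  let ?A = "dual_sw3 s \<alpha>" and ?B = "dual_sw3 s \<beta>"
  have "twisted_mult s \<Delta> S R \<beta> \<alpha> h = (\<Sum>v\<leftarrow>?A. \<Sum>w\<leftarrow>?B.
      tsum R (\<lambda>a b. fst v a * snd (snd w) (S b)) * tsum R (\<lambda>c d. fst (snd v) c * fst w d) *
      tsum (\<Delta> h) (\<lambda>x y. snd (snd v) x * fst (snd w) y))"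
    by (simp add: twisted_mult_def apply_sum case_prod_unfold dual_scale_def pairing2_def
        dual_mult_def dual_antipode_def tsum_def)
  also have "\<dots> = (\<Sum>v\<leftarrow>?A. \<Sum>w\<leftarrow>?B. tsum R (\<lambda>a b. tsum R (\<lambda>c d. tsum (\<Delta> h) (\<lambda>x y.
      (fst v a * fst (snd v) c * snd (snd v) x) * (fst w d * fst (snd w) y * snd (snd w) (S b))))))"
    by (simp add: tsum_left_distrib tsum_right_distrib tsum_swap[of "\<Delta> h"] ac_simps)
  also have "\<dots> = tsum R (\<lambda>a b. tsum R (\<lambda>c d. tsum (\<Delta> h) (\<lambda>x y.
      (\<Sum>v\<leftarrow>?A. fst v a * fst (snd v) c * snd (snd v) x) *
      (\<Sum>w\<leftarrow>?B. fst w d * fst (snd w) y * snd (snd w) (S b)))))"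
    by (simp add: pull split)
  also have "\<dots> = tsum R (\<lambda>a b. tsum R (\<lambda>c d. tsum (\<Delta> h) (\<lambda>x y. \<alpha> (a * c * x) * \<beta> (d * y * S b))))"
    using sum_list_dual_sw3[OF fin \<alpha>] sum_list_dual_sw3[OF fin \<beta>] by (simp add: case_prod_unfold)
  finally show ?thesis .
qed

end

section \<open>Identities of a universal R-matrix\<close>

locale quasitriangular_hopf_algebra = hopf_algebra s \<Delta> \<epsilon> S
  for s :: "'f::field \<Rightarrow> 'k::ring_1 \<Rightarrow> 'k" and \<Delta> \<epsilon> S +
  fixes R :: "('k \<times> 'k) list set"
  assumes R_matrix: "R_matrix s \<Delta> R"
begin

lemma R_intertwines:
  assumes "balanced2 s f"
  shows "tsum R (\<lambda>a b. tsum (\<Delta> h) (\<lambda>x y. f (a * x) (b * y))) =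
         tsum R (\<lambda>a b. tsum (\<Delta> h) (\<lambda>x y. f (y * a) (x * b)))"
proof -
  have "balanced2 s (\<lambda>a b. tsum R (\<lambda>c d. f (a * c) (b * d)))"
    using assms by (simp add: multilinear_simps)
  moreover have "tmult s R (\<Delta> h) = tmult s (tflip s (\<Delta> h)) R"
    using R_matrix by (simp add: R_matrix_def)
  ultimately show ?thesis
    using tsum_tmult[OF assms, of R "\<Delta> h"] tsum_tmult[OF assms, of "tflip s (\<Delta> h)" R]
    by (simp add: tsum_tflip tsum_swap[of R])
qed

text \<open>
  The axiom \<open>(\<Delta> \<otimes> id)(R) = R\<^sub>1\<^sub>3 R\<^sub>2\<^sub>3\<close>, read as a rule that splits the first leg of \<open>R\<close> into two copies;
  the following lemma does the same for \<open>(id \<otimes> \<Delta>)(R) = R\<^sub>1\<^sub>3 R\<^sub>1\<^sub>2\<close>.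
\<close>

lemma hexagon_left:
  assumes "balanced3 s f"
  shows "tsum R (\<lambda>a b. tsum (\<Delta> a) (\<lambda>a1 a2. f a1 a2 b)) =
         tsum R (\<lambda>a b. tsum R (\<lambda>c d. f a c (b * d)))"
proof -
  have "comult_left s \<Delta> R = tmult3 s (leg13 s R) (leg23 s R)"
    using R_matrix by (simp add: R_matrix_def)
  moreover have "balanced3 s (\<lambda>a b d. tsum R (\<lambda>x y. f a (b * x) (d * y)))"
    using assms by (simp add: multilinear_simps)
  moreover have "balanced3 s (\<lambda>a' b' d'. f (a * a') (b * b') (d * d'))" for a b d
    using assms by (simp add: multilinear_simps)
  ultimately show ?thesis
    using tsum3_comult_left[OF assms, of \<Delta> R] by (simp add: tsum3_tmult3 tsum3_leg assms)
qed

lemma hexagon_right: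
  assumes "balanced3 s f"
  shows "tsum R (\<lambda>a b. tsum (\<Delta> b) (\<lambda>b1 b2. f a b1 b2)) =
         tsum R (\<lambda>a b. tsum R (\<lambda>c d. f (a * c) d b))"
proof -
  have "comult_right s \<Delta> R = tmult3 s (leg13 s R) (leg12 s R)"
    using R_matrix by (simp add: R_matrix_def)
  moreover have "balanced3 s (\<lambda>a b d. tsum R (\<lambda>x y. f (a * x) (b * y) d))"
    using assms by (simp add: multilinear_simps)
  moreover have "balanced3 s (\<lambda>a' b' d'. f (a * a') (b * b') (d * d'))" for a b d
    using assms by (simp add: multilinear_simps)
  ultimately show ?thesis
    using tsum3_comult_right[OF assms, of \<Delta> R] by (simp add: tsum3_tmult3 tsum3_leg assms)
qed

text \<open>
  Applying \<open>\<epsilon>\<close> to the first leg of \<open>(\<Delta> \<otimes> id)(R) = R\<^sub>1\<^sub>3 R\<^sub>2\<^sub>3\<close> gives \<open>R = (1 \<otimes> e) R\<close> with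
  \<open>e = \<epsilon>(R\<^sub>1) R\<^sub>2\<close>, and \<open>R\<close> is invertible.
\<close>

lemma counit_R_left: "tsum R (\<lambda>a b. s (\<epsilon> a) b) = 1"
proof -
  let ?e = "tsum R (\<lambda>a b. s (\<epsilon> a) b)"
  obtain R' where R': "tmult s R R' = tone s"
    using R_matrix by (auto simp: R_matrix_def is_tinverse_def)
  \<comment> \<open>multiplication by \<open>R'\<close> followed by \<open>\<epsilon> \<otimes> id\<close>; it sends \<open>R\<close> to 1 and \<open>(1 \<otimes> e) R\<close> to \<open>e\<close>\<close>
  let ?f = "\<lambda>a b. tsum R' (\<lambda>c d. s (\<epsilon> (a * c)) (b * d))"
  have g: "balanced2 s (\<lambda>x y. s (\<epsilon> x) y)"
    by (simp add: multilinear_simps)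
  have inv: "tsum R ?f = 1"
    using tsum_tmult[OF g, of R R'] by (simp add: R' tsum_tone[OF g] counit_one)
  have "1 = tsum R (\<lambda>a b. tsum (\<Delta> a) (\<lambda>a1 a2. ?f (s (\<epsilon> a1) a2) b))"
    using inv tsum_additive[of "\<lambda>x. ?f x b" "\<Delta> a" "\<lambda>a1 a2. s (\<epsilon> a1) a2" for a b]
    by (simp add: tsum_counit_left multilinear_simps)
  also have "\<dots> = tsum R (\<lambda>a b. tsum R (\<lambda>c d. ?f (s (\<epsilon> a) c) (b * d)))"
    by (subst hexagon_left) (simp_all add: multilinear_simps ac_simps)
  also have "\<dots> = ?e * tsum R ?f"
    by (subst tsum_right_distrib)
       (simp add: tsum_left_distrib tsum_scale multilinear_simps ac_simps counit_mult)
  finally show ?thesis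
    by (simp add: inv)
qed

lemma counit_R_right: "tsum R (\<lambda>a b. s (\<epsilon> b) a) = 1"
proof -
  let ?e = "tsum R (\<lambda>a b. s (\<epsilon> b) a)"
  obtain R' where R': "tmult s R R' = tone s"
    using R_matrix by (auto simp: R_matrix_def is_tinverse_def)
  let ?f = "\<lambda>a b. tsum R' (\<lambda>c d. s (\<epsilon> (b * d)) (a * c))"
  have g: "balanced2 s (\<lambda>x y. s (\<epsilon> y) x)"
    by (simp add: multilinear_simps)
  have inv: "tsum R ?f = 1"
    using tsum_tmult[OF g, of R R'] by (simp add: R' tsum_tone[OF g] counit_one)
  have "1 = tsum R (\<lambda>a b. tsum (\<Delta> b) (\<lambda>b1 b2. ?f a (s (\<epsilon> b2) b1)))"
    using inv tsum_additive[of "\<lambda>x. ?f a x" "\<Delta> b" "\<lambda>b1 b2. s (\<epsilon> b2) b1" for a b]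
    by (simp add: tsum_counit_right multilinear_simps)
  also have "\<dots> = tsum R (\<lambda>a b. tsum R (\<lambda>c d. ?f (a * c) (s (\<epsilon> b) d)))"
    by (subst hexagon_right) (simp_all add: multilinear_simps ac_simps)
  also have "\<dots> = ?e * tsum R ?f"
    by (subst tsum_right_distrib)
       (simp add: tsum_left_distrib tsum_scale multilinear_simps ac_simps counit_mult)
  finally show ?thesis
    by (simp add: inv)
qed

text \<open>
  The identity \<open>R (S \<otimes> id)(R) = 1\<close>, obtained by applying \<open>x \<otimes> y \<mapsto> x S(y)\<close> to the first two legs of the
  first hexagon.
\<close>

lemma R_antipode_right:
  assumes f: "balanced2 s f"
  shows "tsum R (\<lambda>a b. tsum R (\<lambda>c d. f (a * S c) (b * d))) = f 1 1"
proof -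
  have add: "f (x + x') y = f x y + f x' y" "f x (y + y') = f x y + f x y'"
    and scale: "f (s c x) y = f x (s c y)" for c x x' y y'
    using f by (simp_all add: balanced2_def)
  have "tsum R (\<lambda>a b. tsum R (\<lambda>c d. f (a * S c) (b * d))) =
      tsum R (\<lambda>a b. tsum (\<Delta> a) (\<lambda>x y. f (x * S y) b))"
    by (subst hexagon_left) (simp_all add: multilinear_simps add scale)
  also have "\<dots> = tsum R (\<lambda>a b. f (s (\<epsilon> a) 1) b)"
    using tsum_additive[of "\<lambda>u. f u b" "\<Delta> a" "\<lambda>x y. x * S y" for a b]
    by (simp add: add tsum_antipode_right)
  also have "\<dots> = f 1 (tsum R (\<lambda>a b. s (\<epsilon> a) b))"
    unfolding scale by (rule tsum_additive[symmetric]) (rule add)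
  finally show ?thesis
    by (simp add: counit_R_left)
qed

text \<open>
  The identity \<open>R\<^sub>1 R'\<^sub>1 \<otimes> R'\<^sub>2 S(R\<^sub>2) = 1 \<otimes> 1\<close>, in which the copies of \<open>R\<close> are nested in the second leg:
  multiply the last two legs of the second hexagon after applying \<open>S\<close> to the last one.  This is what
  cancels the two copies of \<open>R\<close> in the twisted product.
\<close>

lemma R_antipode_inner:
  assumes f: "balanced2 s f"
  shows "tsum R (\<lambda>a b. tsum R (\<lambda>c d. f (a * c) (d * S b))) = f 1 1"
proof -
  have add: "f (x + x') y = f x y + f x' y" "f x (y + y') = f x y + f x y'"
    and scale: "f x (s c y) = f (s c x) y" for c x x' y y'
    using f by (simp_all add: balanced2_def)
  have "tsum R (\<lambda>a b. tsum R (\<lambda>c d. f (a * c) (d * S b))) =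
      tsum R (\<lambda>a b. tsum (\<Delta> b) (\<lambda>x y. f a (x * S y)))"
    by (subst hexagon_right) (simp_all add: multilinear_simps add scale)
  also have "\<dots> = tsum R (\<lambda>a b. f a (s (\<epsilon> b) 1))"
    using tsum_additive[of "f a" "\<Delta> b" "\<lambda>x y. x * S y" for a b]
    by (simp add: add tsum_antipode_right)
  also have "\<dots> = f (tsum R (\<lambda>a b. s (\<epsilon> b) a)) 1"
    unfolding scale by (rule tsum_additive[of "\<lambda>x. f x 1", symmetric]) (rule add)
  finally show ?thesis
    by (simp add: counit_R_right)
qed

text \<open>
  Put \<open>X = (S \<otimes> id)(R)\<close>.  Then \<open>R X = 1\<close> by \<open>R_antipode_right\<close>, while applying \<open>S\<close> to the first leg of
  \<open>R_antipode_inner\<close> gives \<open>X (S \<otimes> S)(R) = 1\<close>.  Hence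
  \<open>(S \<otimes> S)(R) = R X (S \<otimes> S)(R) = R\<close>.
\<close>

lemma R_antipode:
  assumes f: "balanced2 s f"
  shows "tsum R (\<lambda>a b. f (S a) (S b)) = tsum R f"
proof -
  note [simp] = balanced2_rules[OF f]
  have "tsum R (\<lambda>a b. f (S a) (S b)) =
      tsum R (\<lambda>a b. f (1 * S a) (1 * S b))"
    by simp
  also have "\<dots> = tsum R (\<lambda>a b. tsum R (\<lambda>c d. tsum R (\<lambda>p q. f (c * S p * S a) (d * q * S b))))"
    by (subst R_antipode_right[where f = "\<lambda>x y. f (x * S a) (y * S b)" for a b])
       (simp_all add: multilinear_simps)
  also have "\<dots> = tsum R (\<lambda>c d. tsum R (\<lambda>a b. tsum R (\<lambda>p q. f (c * S (a * p)) (d * (q * S b)))))"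
    by (subst tsum_swap) (simp add: antipode_mult mult.assoc)
  also have "\<dots> = tsum R (\<lambda>c d. f (c * S 1) (d * 1))"
    by (subst R_antipode_inner[where f = "\<lambda>x y. f (c * S x) (d * y)" for c d])
       (simp_all add: multilinear_simps)
  finally show ?thesis
    by (simp add: antipode_one)
qed

section \<open>The Drinfeld element and the monodromy element\<close>

text \<open>
  \<open>S\<^sup>2(h) u = u h\<close>: apply \<open>x \<otimes> y \<otimes> z \<mapsto> S\<^sup>2(z) S(y) x\<close> to
  \<open>R\<^sub>1 h\<^sub>1 \<otimes> R\<^sub>2 h\<^sub>2 \<otimes> h\<^sub>3 = h\<^sub>2 R\<^sub>1 \<otimes> h\<^sub>1 R\<^sub>2 \<otimes> h\<^sub>3\<close>.  On the left \<open>S(h\<^sub>2 S(h\<^sub>3))\<close> cancels, on the right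
  \<open>S(h\<^sub>1) h\<^sub>2\<close> does.
\<close>

lemma antipode_square_drinfeld_element:
  "S (S h) * drinfeld_element S R = drinfeld_element S R * h"
proof -
  let ?u = "tsum R (\<lambda>a b. S b * a)"
  have "?u * h = tsum (\<Delta> h) (\<lambda>a b. tsum (\<Delta> b) (\<lambda>x y. S (x * S y) * (?u * a)))"
    by (subst antipode_cancel_right_id[where f = "\<lambda>p q. S q * (?u * p)"])
       (simp_all add: multilinear_simps antipode_one)
  also have "\<dots> = tsum (\<Delta> h) (\<lambda>a b. tsum (\<Delta> a) (\<lambda>x y. S (y * S b) * (?u * x)))"
    by (subst tsum_coassoc) (simp_all add: multilinear_simps)
  also have "\<dots> = tsum (\<Delta> h) (\<lambda>a b.
      tsum R (\<lambda>r t. tsum (\<Delta> a) (\<lambda>x y. S (S b) * S (t * y) * (r * x))))"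
    by (simp add: tsum_left_distrib tsum_right_distrib antipode_mult mult.assoc
        tsum_swap[of R "\<Delta> x" for x])
  also have "\<dots> = tsum (\<Delta> h) (\<lambda>a b.
      tsum R (\<lambda>r t. tsum (\<Delta> a) (\<lambda>x y. S (S b) * S (x * t) * (y * r))))"
    by (subst R_intertwines[where f = "\<lambda>p q. S (S b) * S q * p" for b])
       (simp_all add: multilinear_simps)
  also have "\<dots> = tsum (\<Delta> h) (\<lambda>a b. tsum (\<Delta> a) (\<lambda>x y.
      S (S b) * tsum R (\<lambda>r t. S t * (S x * y) * r)))"
    by (simp add: tsum_left_distrib tsum_right_distrib antipode_mult mult.assoc
        tsum_swap[of R "\<Delta> x" for x])
  also have "\<dots> = S (S h) * ?u"
    by (subst antipode_cancel_left_S[where f = "\<lambda>p q. S (S q) * tsum R (\<lambda>r t. S t * p * r)"])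
       (simp_all add: multilinear_simps flip: tsum_scale)
  finally show ?thesis
    by (simp add: drinfeld_element_def tsum_def)
qed

lemma tsum_Q:
  "balanced2 s f \<Longrightarrow>
     tsum (Q_element s R) f = tsum R (\<lambda>a b. tsum R (\<lambda>c d. f (b * c) (a * d)))"
  unfolding Q_element_def
  by (subst tsum_tmult, assumption, subst tsum_tflip) (simp_all add: multilinear_simps)

text \<open>
  \<open>R\<close> turns \<open>\<Delta>\<close> into \<open>\<Delta>\<^sup>o\<^sup>p\<close> and \<open>R\<^sub>2\<^sub>1\<close> turns it back.
\<close>

lemma Q_commutes_comult:
  assumes f: "balanced2 s f"
  shows "tsum (Q_element s R) (\<lambda>p q. tsum (\<Delta> h) (\<lambda>x y. f (p * x) (q * y))) =
         tsum (Q_element s R) (\<lambda>p q. tsum (\<Delta> h) (\<lambda>x y. f (x * p) (y * q)))"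
proof -
  note [simp] = balanced2_rules[OF f]
  have "tsum (Q_element s R) (\<lambda>p q. tsum (\<Delta> h) (\<lambda>x y. f (p * x) (q * y))) =
    tsum R (\<lambda>a b. tsum R (\<lambda>c d. tsum (\<Delta> h) (\<lambda>x y. f (b * (c * x)) (a * (d * y)))))"
    by (subst tsum_Q) (simp_all add: multilinear_simps mult.assoc)
  also have "\<dots> = tsum R (\<lambda>a b. tsum R (\<lambda>c d. tsum (\<Delta> h) (\<lambda>x y. f (b * (y * c)) (a * (x * d)))))"
    by (subst R_intertwines[where f = "\<lambda>u v. f (b * u) (a * v)" for a b])
       (simp_all add: multilinear_simps)
  also have "\<dots> = tsum R (\<lambda>c d. tsum R (\<lambda>a b. tsum (\<Delta> h) (\<lambda>x y. f (b * y * c) (a * x * d))))"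
    by (subst tsum_swap) (simp add: mult.assoc)
  also have "\<dots> = tsum R (\<lambda>c d. tsum R (\<lambda>a b. tsum (\<Delta> h) (\<lambda>x y. f (x * b * c) (y * a * d))))"
    by (subst R_intertwines[where f = "\<lambda>u v. f (v * c) (u * d)" for c d])
       (simp_all add: multilinear_simps)
  also have "\<dots> = tsum R (\<lambda>a b. tsum R (\<lambda>c d. tsum (\<Delta> h) (\<lambda>x y. f (x * (b * c)) (y * (a * d)))))"
    by (subst tsum_swap) (simp add: mult.assoc)
  also have "\<dots> = tsum (Q_element s R) (\<lambda>p q. tsum (\<Delta> h) (\<lambda>x y. f (x * p) (y * q)))"
    by (subst tsum_Q) (simp_all add: multilinear_simps)
  finally show ?thesis .
qed

text \<open>
  \<open>S \<otimes> S\<close> fixes \<open>R\<close> and reverses products, so it sends \<open>R\<^sub>2\<^sub>1 R\<close> to \<open>R R\<^sub>2\<^sub>1\<close>, the flip of \<open>Q\<close>.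
\<close>

lemma Q_antipode:
  assumes f: "balanced2 s f"
  shows "tsum (Q_element s R) (\<lambda>p q. f (S q) (S p)) = tsum (Q_element s R) f"
proof -
  note [simp] = balanced2_rules[OF f]
  have "tsum (Q_element s R) (\<lambda>p q. f (S q) (S p)) =
      tsum R (\<lambda>a b. tsum R (\<lambda>c d. f (S d * S a) (S c * S b)))"
    by (subst tsum_Q) (simp_all add: multilinear_simps antipode_mult)
  also have "\<dots> = tsum R (\<lambda>a b. tsum R (\<lambda>c d. f (d * S a) (c * S b)))"
    by (subst R_antipode[where f = "\<lambda>u v. f (v * S a) (u * S b)" for a b])
       (simp_all add: multilinear_simps)
  also have "\<dots> = tsum R (\<lambda>c d. tsum R (\<lambda>a b. f (d * S a) (c * S b)))"
    by (rule tsum_swap)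
  also have "\<dots> = tsum R (\<lambda>c d. tsum R (\<lambda>a b. f (d * a) (c * b)))"
    by (subst R_antipode[where f = "\<lambda>u v. f (d * u) (c * v)" for c d])
       (simp_all add: multilinear_simps)
  also have "\<dots> = tsum (Q_element s R) f"
    by (rule tsum_Q[OF f, symmetric])
  finally show ?thesis .
qed

text \<open>
  \<open>(id \<otimes> \<Delta>)(Q) = R\<^sub>2\<^sub>1 R\<^sub>3\<^sub>1 R\<^sub>1\<^sub>3 R\<^sub>1\<^sub>2 = R\<^sub>2\<^sub>1 Q\<^sub>1\<^sub>3 R\<^sub>1\<^sub>2\<close> by the two hexagons.
\<close>

lemma comult_right_Q:
  assumes f: "balanced3 s f"
  shows "tsum (Q_element s R) (\<lambda>p q. tsum (\<Delta> q) (\<lambda>x y. f p x y)) =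
         tsum R (\<lambda>m n. tsum R (\<lambda>a b. tsum (Q_element s R) (\<lambda>p q. f (b * p * m) (a * n) q)))"
proof -
  note [simp] = balanced3_rules[OF f]
  have "tsum (Q_element s R) (\<lambda>p q. tsum (\<Delta> q) (\<lambda>x y. f p x y)) =
      tsum R (\<lambda>a b. tsum R (\<lambda>c d. tsum (\<Delta> (a * d)) (\<lambda>x y. f (b * c) x y)))"
    by (subst tsum_Q) (simp_all add: multilinear_simps)
  also have "\<dots> = tsum R (\<lambda>a b. tsum (\<Delta> a) (\<lambda>a1 a2. tsum R (\<lambda>c d. tsum (\<Delta> d) (\<lambda>d1 d2.
      f (b * c) (a1 * d1) (a2 * d2)))))"
    by (subst tsum_comult_mult) (simp_all add: multilinear_simps tsum_swap[of R "\<Delta> x" for x])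
  also have "\<dots> = tsum R (\<lambda>a b. tsum R (\<lambda>p q. tsum R (\<lambda>c d. tsum (\<Delta> d) (\<lambda>d1 d2.
      f (b * q * c) (a * d1) (p * d2)))))"
    by (subst hexagon_left) (simp_all add: multilinear_simps)
  also have "\<dots> = tsum R (\<lambda>a b. tsum R (\<lambda>p q. tsum R (\<lambda>c d. tsum R (\<lambda>m n.
      f (b * q * (c * m)) (a * n) (p * d)))))"
    by (subst hexagon_right) (simp_all add: multilinear_simps)
  also have "\<dots> = tsum R (\<lambda>a b. tsum (Q_element s R) (\<lambda>p q. tsum R (\<lambda>m n. f (b * p * m) (a * n) q)))"
    by (subst tsum_Q) (simp_all add: multilinear_simps mult.assoc)
  also have "\<dots> = tsum R (\<lambda>a b. tsum R (\<lambda>m n. tsum (Q_element s R) (\<lambda>p q. f (b * p * m) (a * n) q)))"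
    by (subst tsum_swap) simp
  also have "\<dots> = tsum R (\<lambda>m n. tsum R (\<lambda>a b. tsum (Q_element s R) (\<lambda>p q. f (b * p * m) (a * n) q)))"
    by (rule tsum_swap)
  finally show ?thesis .
qed

text \<open>
  The tensor \<open>R'\<^sub>2\<^sub>3 R\<^sub>2\<^sub>1\<close> is \<open>R\<^sub>1\<close> in the second leg and \<open>\<Delta>(R\<^sub>2)\<close> in the outer ones, hence commutes with
  \<open>Q\<^sub>1\<^sub>3\<close>.  Once \<open>R'\<close> stands to the right of \<open>Q\<close>, it is adjacent to the remaining factor \<open>S(R\<^sub>2)\<close> and
  cancels by \<open>R_antipode_inner\<close>.
\<close>

lemma R_conjugates_Q:
  assumes f: "balanced3 s f"
  shows "tsum R (\<lambda>a b. tsum (Q_element s R) (\<lambda>p q. tsum R (\<lambda>c d. tsum R (\<lambda>e g.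
           f (b * p) (c * e * a) (g * q * S d))))) =
         tsum (Q_element s R) (\<lambda>p q. tsum R (\<lambda>a b. f (p * b) a q))"
proof -
  note [simp] = balanced3_rules[OF f]
  let ?Q = "Q_element s R"
  have "tsum R (\<lambda>a b. tsum ?Q (\<lambda>p q. tsum R (\<lambda>c d. tsum R (\<lambda>e g.
           f (b * p) (c * e * a) (g * q * S d))))) =
       tsum R (\<lambda>c d. tsum R (\<lambda>e g. tsum R (\<lambda>a b. tsum ?Q (\<lambda>p q.
           f (b * p) (c * (e * a)) (g * q * S d)))))"
    by (simp add: mult.assoc tsum_swap[of ?Q R]) (rule tsum_rotate)
  also have "\<dots> = tsum R (\<lambda>c d. tsum R (\<lambda>a b. tsum ?Q (\<lambda>p q. tsum (\<Delta> b) (\<lambda>x y.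
           f (x * p) (c * a) (y * q * S d)))))"
    by (subst hexagon_right[symmetric]) (simp_all add: multilinear_simps tsum_swap[of ?Q "\<Delta> x" for x])
  also have "\<dots> = tsum R (\<lambda>c d. tsum R (\<lambda>a b. tsum ?Q (\<lambda>p q. tsum (\<Delta> b) (\<lambda>x y.
           f (p * x) (c * a) (q * y * S d)))))"
    by (subst Q_commutes_comult[where f = "\<lambda>u v. f u (c * a) (v * S d)" for a c d])
       (simp_all add: multilinear_simps)
  also have "\<dots> = tsum R (\<lambda>c d. tsum R (\<lambda>e g. tsum R (\<lambda>a b. tsum ?Q (\<lambda>p q.
           f (p * b) (c * (e * a)) (q * g * S d)))))"
    by (simp only: tsum_swap[of ?Q "\<Delta> x" for x], subst hexagon_right) (simp_all add: multilinear_simps)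
  also have "\<dots> = tsum ?Q (\<lambda>p q. tsum R (\<lambda>a b. tsum R (\<lambda>c d. tsum R (\<lambda>e g.
           f (p * b) (c * e * a) (q * (g * S d))))))"
    by (simp add: mult.assoc tsum_swap[of ?Q R]) (rule tsum_rotate[symmetric])
  also have "\<dots> = tsum ?Q (\<lambda>p q. tsum R (\<lambda>a b. f (p * b) (1 * a) (q * 1)))"
    by (subst R_antipode_inner[where f = "\<lambda>u v. f (p * b) (u * a) (q * v)" for p b a q])
       (simp_all add: multilinear_simps)
  finally show ?thesis
    by simp
qed

text \<open>
  The tensor identity behind the multiplicativity of \<open>\<Phi>\<close>: for \<open>f x y z = \<alpha>(y) \<beta>(z) x\<close> the left-hand
  side is \<open>\<Phi>(\<beta> \<cdot>' \<alpha>)\<close> and the right-hand side \<open>\<Phi>(\<beta>) \<Phi>(\<alpha>)\<close>.  In \<open>(id \<otimes> \<Delta>)(Q) = R\<^sub>2\<^sub>1 Q\<^sub>1\<^sub>3 R\<^sub>1\<^sub>2\<close> the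
  preceding lemma moves \<open>R\<^sub>2\<^sub>1\<close> to the right of \<open>Q\<^sub>1\<^sub>3\<close>, where it forms a second \<open>Q\<close> with \<open>R\<^sub>1\<^sub>2\<close>.
\<close>

lemma Q_transports_twisted_product:
  assumes f: "balanced3 s f"
  shows "tsum (Q_element s R) (\<lambda>p q. tsum R (\<lambda>a b. tsum R (\<lambda>c d. tsum (\<Delta> q) (\<lambda>x y.
           f p (a * c * x) (d * y * S b))))) =
         tsum (Q_element s R) (\<lambda>p q. tsum (Q_element s R) (\<lambda>p' q'. f (p' * p) q q'))"
proof -
  note [simp] = balanced3_rules[OF f]
  let ?Q = "Q_element s R"
  have "tsum ?Q (\<lambda>p q. tsum R (\<lambda>a b. tsum R (\<lambda>c d. tsum (\<Delta> q) (\<lambda>x y. f p (a * c * x) (d * y * S b))))) =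
      tsum ?Q (\<lambda>p q. tsum (\<Delta> q) (\<lambda>x y. tsum R (\<lambda>c d. tsum R (\<lambda>e g. f p (c * e * x) (g * y * S d)))))"
    by (simp only: tsum_swap[of R "\<Delta> x" for x])
  also have "\<dots> = tsum R (\<lambda>m n. tsum R (\<lambda>a b. tsum ?Q (\<lambda>p q. tsum R (\<lambda>c d. tsum R (\<lambda>e g.
           f (b * p * m) (c * e * a * n) (g * q * S d))))))"
    by (subst comult_right_Q) (simp_all add: multilinear_simps mult.assoc)
  also have "\<dots> = tsum R (\<lambda>m n. tsum ?Q (\<lambda>p q. tsum R (\<lambda>a b. f (p * b * m) (a * n) q)))"
    by (subst R_conjugates_Q[where f = "\<lambda>u v w. f (u * m) (v * n) w" for m n])
       (simp_all add: multilinear_simps)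
  also have "\<dots> = tsum ?Q (\<lambda>p' q'. tsum R (\<lambda>a b. tsum R (\<lambda>m n. f (p' * (b * m)) (a * n) q')))"
    by (simp add: mult.assoc tsum_swap[of ?Q R]) (rule tsum_swap)
  also have "\<dots> = tsum ?Q (\<lambda>p' q'. tsum ?Q (\<lambda>p q. f (p' * p) q q'))"
    by (subst tsum_Q[where f = "\<lambda>p q. f (p' * p) q q'" for p' q']) (simp_all add: multilinear_simps)
  also have "\<dots> = tsum ?Q (\<lambda>p q. tsum ?Q (\<lambda>p' q'. f (p' * p) q q'))"
    by (rule tsum_swap)
  finally show ?thesis .
qed

section \<open>Associativity of the twisted product\<close>

text \<open>
  \<open>R\<^sub>1\<^sub>2 R\<^sub>1\<^sub>3 R\<^sub>2\<^sub>3 = R\<^sub>2\<^sub>3 R\<^sub>1\<^sub>3 R\<^sub>1\<^sub>2\<close>: fuse \<open>R\<^sub>1\<^sub>3 R\<^sub>2\<^sub>3\<close> to \<open>(\<Delta> \<otimes> id)(R)\<close>, move \<open>R\<^sub>1\<^sub>2\<close> through it by the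
  intertwining property, and split again.
\<close>

lemma Yang_Baxter:
  assumes f: "balanced3 s f"
  shows "tsum R (\<lambda>a b. tsum R (\<lambda>c d. tsum R (\<lambda>m n. f (a * c) (b * m) (d * n)))) =
         tsum R (\<lambda>a b. tsum R (\<lambda>c d. tsum R (\<lambda>m n. f (c * m) (a * n) (b * d))))"
proof -
  note [simp] = balanced3_rules[OF f]
  have "tsum R (\<lambda>a b. tsum R (\<lambda>c d. tsum R (\<lambda>m n. f (a * c) (b * m) (d * n)))) =
      tsum R (\<lambda>a b. tsum R (\<lambda>c d. tsum (\<Delta> c) (\<lambda>x y. f (a * x) (b * y) d)))"
    by (subst hexagon_left) (simp_all add: multilinear_simps)
  also have "\<dots> = tsum R (\<lambda>c d. tsum R (\<lambda>a b. tsum (\<Delta> c) (\<lambda>x y. f (a * x) (b * y) d)))"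
    by (rule tsum_swap)
  also have "\<dots> = tsum R (\<lambda>c d. tsum R (\<lambda>a b. tsum (\<Delta> c) (\<lambda>x y. f (y * a) (x * b) d)))"
    by (subst R_intertwines[where f = "\<lambda>u v. f u v d" for d]) (simp_all add: multilinear_simps)
  also have "\<dots> = tsum R (\<lambda>c d. tsum (\<Delta> c) (\<lambda>x y. tsum R (\<lambda>a b. f (y * a) (x * b) d)))"
    by (simp only: tsum_swap[of R "\<Delta> x" for x])
  also have "\<dots> = tsum R (\<lambda>a b. tsum R (\<lambda>c d. tsum R (\<lambda>m n. f (c * m) (a * n) (b * d))))"
    by (subst hexagon_left) (simp_all add: multilinear_simps)
  finally show ?thesis .
qed

text \<open>
  What remains of associativity after all coproducts of products have been split and \<open>x\<close>, \<open>y\<close>, \<open>z\<close> are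
  the three pieces of the argument.  The copy \<open>(c', d')\<close> is moved through the coproduct of \<open>a\<close>; it then
  stands next to the copies \<open>(c, d)\<close> and \<open>(m, n)\<close>, to which the Yang--Baxter equation applies.
\<close>

lemma twisted_exchange:
  assumes f: "balanced3 s f"
  shows "tsum R (\<lambda>a b. tsum (\<Delta> a) (\<lambda>a1 a2. tsum R (\<lambda>c d. tsum R (\<lambda>m n. tsum R (\<lambda>a' b'.
           tsum R (\<lambda>c' d'. f (a' * c' * a1 * c * x) (d' * a2 * m * y * S b') (d * n * z * S b))))))) =
         tsum R (\<lambda>a b. tsum R (\<lambda>p q. tsum R (\<lambda>c d. tsum R (\<lambda>m n. tsum R (\<lambda>a' b'.
           tsum R (\<lambda>c' d'. f (a * p * c * m * x) (a' * c' * n * y * S b) (d' * d * z * S q * S b')))))))"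
proof -
  note [simp] = balanced3_rules[OF f]
  have "tsum R (\<lambda>a b. tsum (\<Delta> a) (\<lambda>a1 a2. tsum R (\<lambda>c d. tsum R (\<lambda>m n. tsum R (\<lambda>a' b'.
           tsum R (\<lambda>c' d'. f (a' * c' * a1 * c * x) (d' * a2 * m * y * S b') (d * n * z * S b))))))) =
      tsum R (\<lambda>a b. tsum R (\<lambda>c d. tsum R (\<lambda>m n. tsum R (\<lambda>a' b'. tsum R (\<lambda>c' d'. tsum (\<Delta> a) (\<lambda>a1 a2.
           f (a' * (c' * a1) * c * x) (d' * a2 * m * y * S b') (d * n * z * S b)))))))"
    by (simp only: tsum_swap[of R "\<Delta> x" for x] mult.assoc)
  also have "\<dots> = tsum R (\<lambda>a b. tsum R (\<lambda>c d. tsum R (\<lambda>m n. tsum R (\<lambda>a' b'. tsum R (\<lambda>c' d'. tsum (\<Delta> a) (\<lambda>a1 a2.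
           f (a' * (a2 * c') * c * x) (a1 * d' * m * y * S b') (d * n * z * S b)))))))"
    by (subst R_intertwines[where f = "\<lambda>u v. f (a' * u * c * x) (v * m * y * S b') (d * n * z * S b)" for a' b' c d m n b])
       (simp_all add: multilinear_simps)
  also have "\<dots> = tsum R (\<lambda>a b. tsum (\<Delta> a) (\<lambda>a1 a2. tsum R (\<lambda>c d. tsum R (\<lambda>m n. tsum R (\<lambda>a' b'. tsum R (\<lambda>c' d'.
           f (a' * (a2 * c') * c * x) (a1 * d' * m * y * S b') (d * n * z * S b)))))))"
    by (simp only: tsum_swap[of R "\<Delta> x" for x])
  also have "\<dots> = tsum R (\<lambda>a b. tsum R (\<lambda>p q. tsum R (\<lambda>c d. tsum R (\<lambda>m n. tsum R (\<lambda>a' b'. tsum R (\<lambda>c' d'.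
           f (a' * (p * c') * c * x) (a * d' * m * y * S b') (d * n * z * S (b * q))))))))"
    by (subst hexagon_left) (simp_all add: multilinear_simps)
  \<comment> \<open>only independent sums are permuted, to make the arguments of the Yang--Baxter equation innermost\<close>
  also have "\<dots> = tsum R (\<lambda>a b. tsum R (\<lambda>p q. tsum R (\<lambda>a' b'.
         tsum R (\<lambda>c' d'. tsum R (\<lambda>c d. tsum R (\<lambda>m n.
           f (a' * (p * (c' * c)) * x) (a * (d' * m) * y * S b') (d * n * z * S (b * q))))))))"
    by (simp only: mult.assoc, rule tsum_cong, rule tsum_cong, rule tsum_swap_pairs)
  also have "\<dots> = tsum R (\<lambda>a b. tsum R (\<lambda>p q. tsum R (\<lambda>a' b'.
         tsum R (\<lambda>c' d'. tsum R (\<lambda>c d. tsum R (\<lambda>m n.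
           f (a' * (p * (c * m)) * x) (a * (c' * n) * y * S b') (d' * d * z * S (b * q))))))))"
    by (subst Yang_Baxter[where f = "\<lambda>u v w. f (a' * (p * u) * x) (a * v * y * S b') (w * z * S (b * q))" for a' p a b' b q])
       (simp_all add: multilinear_simps)
  \<comment> \<open>the names \<open>(a, b)\<close> and \<open>(a', b')\<close> are exchanged\<close>
  also have "\<dots> = tsum R (\<lambda>a b. tsum R (\<lambda>p q. tsum R (\<lambda>c d. tsum R (\<lambda>m n. tsum R (\<lambda>a' b'.
           tsum R (\<lambda>c' d'. f (a * p * c * m * x) (a' * c' * n * y * S b) (d' * d * z * S q * S b')))))))"
    by (rule HOL.trans[OF tsum_rotate], rule HOL.trans[OF tsum_swap], rule tsum_cong, rule tsum_cong,
        rule HOL.trans[OF tsum_swap_pairs]) (simp only: antipode_mult mult.assoc)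
  finally show ?thesis .
qed

text \<open>
  For \<open>f x y z = \<alpha>(x) \<beta>(y) \<gamma>(z)\<close> the two sides are \<open>((\<gamma> \<cdot>' \<beta>) \<cdot>' \<alpha>)(h)\<close> and \<open>(\<gamma> \<cdot>' (\<beta> \<cdot>' \<alpha>))(h)\<close>.  Splitting
  every coproduct brings them to the forms \<open>G(h\<^sub>1, h\<^sub>2, h\<^sub>3)\<close> and \<open>G'(h\<^sub>1, h\<^sub>2, h\<^sub>3)\<close>, where \<open>G\<close> and \<open>G'\<close>
  are sums over copies of \<open>R\<close> alone and agree by \<open>twisted_exchange\<close>.
\<close>

lemma twisted_product_assoc:
  assumes f: "balanced3 s f"
  shows "tsum R (\<lambda>a b. tsum R (\<lambda>c d. tsum (\<Delta> h) (\<lambda>x y. tsum R (\<lambda>a' b'. tsum R (\<lambda>c' d'.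
           tsum (\<Delta> (d * y * S b)) (\<lambda>u v. f (a * c * x) (a' * c' * u) (d' * v * S b')))))))=
         tsum R (\<lambda>a b. tsum R (\<lambda>c d. tsum (\<Delta> h) (\<lambda>x y. tsum R (\<lambda>a' b'. tsum R (\<lambda>c' d'.
           tsum (\<Delta> (a * c * x)) (\<lambda>u v. f (a' * c' * u) (d' * v * S b') (d * y * S b)))))))"
proof -
  note [simp] = balanced3_rules[OF f]
  let ?G = "\<lambda>x y z. tsum R (\<lambda>a b. tsum R (\<lambda>p q. tsum R (\<lambda>c d. tsum R (\<lambda>m n. tsum R (\<lambda>a' b'.
           tsum R (\<lambda>c' d'. f (a * p * c * m * x) (a' * c' * n * y * S b) (d' * d * z * S q * S b')))))))"
  \<comment> \<open>with this order of the sums those over \<open>\<Delta> y\<close>, \<open>\<Delta> b\<close> and \<open>\<Delta> d\<close> in the first expansion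
    can each move out to the sum that supplies \<open>y\<close>, \<open>b\<close> or \<open>d\<close>\<close>
  have comult3: "tsum (\<Delta> (d * y * e)) g = tsum (\<Delta> y) (\<lambda>y1 y2. tsum (\<Delta> e) (\<lambda>e1 e2.
      tsum (\<Delta> d) (\<lambda>d1 d2. g (d1 * y1 * e1) (d2 * y2 * e2))))"
    if g: "balanced2 s g" for d y e and g :: "'k \<Rightarrow> 'k \<Rightarrow> 'v::ab_group_add"
  proof -
    note [simp] = balanced2_rules[OF g]
    show ?thesis
      by (subst tsum_comult_mult[OF g], subst tsum_comult_mult)
         (simp_all add: multilinear_simps tsum_rotate[of "\<Delta> d"])
  qed
  have "tsum R (\<lambda>a b. tsum R (\<lambda>c d. tsum (\<Delta> h) (\<lambda>x y. tsum R (\<lambda>a' b'. tsum R (\<lambda>c' d'.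
           tsum (\<Delta> (d * y * S b)) (\<lambda>u v. f (a * c * x) (a' * c' * u) (d' * v * S b')))))))=
      tsum R (\<lambda>a b. tsum R (\<lambda>c d. tsum (\<Delta> h) (\<lambda>x y. tsum R (\<lambda>a' b'. tsum R (\<lambda>c' d'.
        tsum (\<Delta> y) (\<lambda>y1 y2. tsum (\<Delta> b) (\<lambda>b1 b2. tsum (\<Delta> d) (\<lambda>d1 d2.
           f (a * c * x) (a' * c' * (d1 * y1 * S b2)) (d' * (d2 * y2 * S b1) * S b')))))))))"
    by (subst comult3, simp add: multilinear_simps, subst tsum_comult_antipode)
       (simp_all add: multilinear_simps)
  also have "\<dots> = tsum (\<Delta> h) (\<lambda>x y. tsum (\<Delta> y) (\<lambda>y1 y2.
      tsum R (\<lambda>a b. tsum (\<Delta> b) (\<lambda>b1 b2. tsum R (\<lambda>c d. tsum (\<Delta> d) (\<lambda>d1 d2.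
        tsum R (\<lambda>a' b'. tsum R (\<lambda>c' d'.
           f (a * c * x) (a' * c' * (d1 * y1 * S b2)) (d' * (d2 * y2 * S b1) * S b')))))))))"
    by (simp only: tsum_swap[of R "\<Delta> x" for x])
  also have "\<dots> = tsum (\<Delta> h) (\<lambda>x y. tsum (\<Delta> y) (\<lambda>y1 y2.
      tsum R (\<lambda>a b. tsum (\<Delta> b) (\<lambda>b1 b2. tsum R (\<lambda>c d. tsum R (\<lambda>m n.
        tsum R (\<lambda>a' b'. tsum R (\<lambda>c' d'.
           f (a * (c * m) * x) (a' * c' * (n * y1 * S b2)) (d' * (d * y2 * S b1) * S b')))))))))"
    by (subst hexagon_right) (simp_all add: multilinear_simps)
  also have "\<dots> = tsum (\<Delta> h) (\<lambda>x y. tsum (\<Delta> y) (\<lambda>y1 y2. ?G x y1 y2))"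
    by (subst hexagon_right) (simp_all add: multilinear_simps mult.assoc)
  also have "\<dots> = tsum (\<Delta> h) (\<lambda>x y. tsum (\<Delta> x) (\<lambda>x1 x2. ?G x1 x2 y))"
    by (subst tsum_coassoc[symmetric]) (simp_all add: multilinear_simps)
  also have "\<dots> = tsum (\<Delta> h) (\<lambda>x y. tsum (\<Delta> x) (\<lambda>x1 x2.
      tsum R (\<lambda>a b. tsum (\<Delta> a) (\<lambda>a1 a2. tsum R (\<lambda>c d. tsum R (\<lambda>m n.
        tsum R (\<lambda>a' b'. tsum R (\<lambda>c' d'.
           f (a' * c' * a1 * c * x1) (d' * a2 * m * x2 * S b') (d * n * y * S b)))))))))"
    by (simp only: twisted_exchange[OF f])
  also have "\<dots> = tsum (\<Delta> h) (\<lambda>x y. tsum (\<Delta> x) (\<lambda>x1 x2.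
      tsum R (\<lambda>a b. tsum (\<Delta> a) (\<lambda>a1 a2. tsum R (\<lambda>c d. tsum (\<Delta> c) (\<lambda>c1 c2.
        tsum R (\<lambda>a' b'. tsum R (\<lambda>c' d'.
           f (a' * c' * (a1 * c1 * x1)) (d' * (a2 * c2 * x2) * S b') (d * y * S b)))))))))"
    by (subst hexagon_left) (simp_all add: multilinear_simps mult.assoc)
  also have "\<dots> = tsum R (\<lambda>a b. tsum R (\<lambda>c d. tsum (\<Delta> h) (\<lambda>x y. tsum R (\<lambda>a' b'. tsum R (\<lambda>c' d'.
        tsum (\<Delta> x) (\<lambda>x1 x2. tsum (\<Delta> a) (\<lambda>a1 a2. tsum (\<Delta> c) (\<lambda>c1 c2.
           f (a' * c' * (a1 * c1 * x1)) (d' * (a2 * c2 * x2) * S b') (d * y * S b)))))))))"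
    by (simp only: tsum_swap[of R "\<Delta> x" for x])
  also have "\<dots> = tsum R (\<lambda>a b. tsum R (\<lambda>c d. tsum (\<Delta> h) (\<lambda>x y. tsum R (\<lambda>a' b'. tsum R (\<lambda>c' d'.
           tsum (\<Delta> (a * c * x)) (\<lambda>u v. f (a' * c' * u) (d' * v * S b') (d * y * S b)))))))"
    by (subst comult3, simp add: multilinear_simps,
        subst tsum_rotate[of "\<Delta> c" "\<Delta> x" "\<Delta> a" for a c x, symmetric], rule HOL.refl)
  finally show ?thesis .
qed

lemma twisted_mult_assoc:
  assumes fin: "finite_dimensional s"
    and \<alpha>: "\<alpha> \<in> dual s" and \<beta>: "\<beta> \<in> dual s" and \<gamma>: "\<gamma> \<in> dual s"
    and \<beta>\<alpha>: "twisted_mult s \<Delta> S R \<beta> \<alpha> \<in> dual s" and \<gamma>\<beta>: "twisted_mult s \<Delta> S R \<gamma> \<beta> \<in> dual s"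
  shows "twisted_mult s \<Delta> S R (twisted_mult s \<Delta> S R \<gamma> \<beta>) \<alpha> =
         twisted_mult s \<Delta> S R \<gamma> (twisted_mult s \<Delta> S R \<beta> \<alpha>)"
proof
  fix h
  have "balanced3 s (\<lambda>x y z. \<alpha> x * \<beta> y * \<gamma> z)"
    using \<alpha> \<beta> \<gamma> by (simp add: dual_iff multilinear_simps ac_simps)
  from twisted_product_assoc[OF this, of h]
  show "twisted_mult s \<Delta> S R (twisted_mult s \<Delta> S R \<gamma> \<beta>) \<alpha> h =
        twisted_mult s \<Delta> S R \<gamma> (twisted_mult s \<Delta> S R \<beta> \<alpha>) h"
    by (simp add: twisted_mult_apply[OF fin \<alpha> \<gamma>\<beta>] twisted_mult_apply[OF fin \<beta>\<alpha> \<gamma>])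
       (simp add: twisted_mult_apply[OF fin \<alpha> \<beta>] twisted_mult_apply[OF fin \<beta> \<gamma>]
         tsum_left_distrib tsum_right_distrib mult.assoc)
qed

text \<open>
  For \<open>\<beta> = \<epsilon>\<close> both second legs of \<open>R\<close> are evaluated by \<open>\<epsilon>\<close>, and
  \<open>R\<^sub>1 \<epsilon>(R\<^sub>2) = 1\<close>; the right unit law is symmetric.
\<close>

lemma twisted_mult_counit_left:
  assumes fin: "finite_dimensional s" and \<alpha>: "\<alpha> \<in> dual s"
  shows "twisted_mult s \<Delta> S R \<epsilon> \<alpha> = \<alpha>"
proof
  fix h
  have \<alpha>': "\<alpha> (x + y) = \<alpha> x + \<alpha> y" "\<alpha> (s c x) = c * \<alpha> x" for x y c
    using \<alpha> by (simp_all add: dual_iff)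
  have "twisted_mult s \<Delta> S R \<epsilon> \<alpha> h = tsum R (\<lambda>a b. tsum R (\<lambda>c d. tsum (\<Delta> h) (\<lambda>x y.
      \<alpha> (s (\<epsilon> b) a * s (\<epsilon> d) c * s (\<epsilon> y) x))))"
    by (simp add: twisted_mult_apply[OF fin \<alpha> counit_in_dual] \<alpha>' counit_mult counit_antipode ac_simps)
  also have "\<dots> = \<alpha> (tsum R (\<lambda>a b. s (\<epsilon> b) a) * tsum R (\<lambda>c d. s (\<epsilon> d) c) *
      tsum (\<Delta> h) (\<lambda>x y. s (\<epsilon> y) x))"
    by (simp only: tsum_additive[of \<alpha>, OF \<alpha>'(1)] tsum_left_distrib tsum_right_distrib tsum_swap[of "\<Delta> h"])
       (rule tsum_swap)
  finally show "twisted_mult s \<Delta> S R \<epsilon> \<alpha> h = \<alpha> h"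
    by (simp add: counit_R_right tsum_counit_right)
qed

lemma twisted_mult_counit_right:
  assumes fin: "finite_dimensional s" and \<beta>: "\<beta> \<in> dual s"
  shows "twisted_mult s \<Delta> S R \<beta> \<epsilon> = \<beta>"
proof
  fix h
  have \<beta>': "\<beta> (x + y) = \<beta> x + \<beta> y" "\<beta> (s c x) = c * \<beta> x" for x y c
    using \<beta> by (simp_all add: dual_iff)
  have "twisted_mult s \<Delta> S R \<beta> \<epsilon> h = tsum R (\<lambda>a b. tsum R (\<lambda>c d. tsum (\<Delta> h) (\<lambda>x y.
      \<beta> (s (\<epsilon> c) d * s (\<epsilon> x) y * S (s (\<epsilon> a) b)))))"
    by (simp add: twisted_mult_apply[OF fin counit_in_dual \<beta>] \<beta>' counit_mult antipode_scale ac_simps)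
  also have "\<dots> = \<beta> (tsum R (\<lambda>c d. s (\<epsilon> c) d) * tsum (\<Delta> h) (\<lambda>x y. s (\<epsilon> x) y) *
      S (tsum R (\<lambda>a b. s (\<epsilon> a) b)))"
    by (simp only: tsum_additive[of \<beta>, OF \<beta>'(1)] tsum_additive[of S, OF antipode_add]
        tsum_left_distrib tsum_right_distrib tsum_swap[of "\<Delta> h"])
  finally show "twisted_mult s \<Delta> S R \<beta> \<epsilon> h = \<beta> h"
    by (simp add: counit_R_left tsum_counit_left antipode_one)
qed

lemma twisted_mult_algebra:
  assumes fin: "finite_dimensional s"
  shows "algebra_on dual_scale (dual s) (twisted_mult s \<Delta> S R) \<epsilon>"
proof -
  have vs: "vector_space (dual_scale :: 'f \<Rightarrow> ('k \<Rightarrow> 'f) \<Rightarrow> 'k \<Rightarrow> 'f)"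
    by unfold_locales (auto simp: dual_scale_def fun_eq_iff algebra_simps)
  then interpret dual: vector_space "dual_scale :: 'f \<Rightarrow> ('k \<Rightarrow> 'f) \<Rightarrow> 'k \<Rightarrow> 'f" .
  have subspace: "dual.subspace (dual s)"
    unfolding dual.subspace_def by (auto simp: dual_iff dual_scale_def algebra_simps)
  note tw = twisted_mult_apply[OF fin]
  have closed: "twisted_mult s \<Delta> S R \<beta> \<alpha> \<in> dual s" if \<alpha>: "\<alpha> \<in> dual s" and \<beta>: "\<beta> \<in> dual s" for \<alpha> \<beta>
    using \<alpha> \<beta> unfolding dual_iff[of "twisted_mult s \<Delta> S R \<beta> \<alpha>"] tw[OF that]
    by (auto simp: dual_iff multilinear_simps ac_simps tsum_left_distrib)
  have add: "\<alpha> + \<alpha>' \<in> dual s" if "\<alpha> \<in> dual s" "\<alpha>' \<in> dual s" for \<alpha> \<alpha>'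
    using that dual.subspace_add[OF subspace] by blast
  have scale: "dual_scale c \<alpha> \<in> dual s" if "\<alpha> \<in> dual s" for c \<alpha>
    using that dual.subspace_scale[OF subspace] by blast
  have dual_scale_apply: "dual_scale c \<alpha> h = c * \<alpha> h" for c \<alpha> and h :: 'k
    by (simp add: dual_scale_def)
  have bilinear:
    "twisted_mult s \<Delta> S R (\<beta> + \<beta>') \<alpha> = twisted_mult s \<Delta> S R \<beta> \<alpha> + twisted_mult s \<Delta> S R \<beta>' \<alpha>"
    "twisted_mult s \<Delta> S R \<alpha> (\<beta> + \<beta>') = twisted_mult s \<Delta> S R \<alpha> \<beta> + twisted_mult s \<Delta> S R \<alpha> \<beta>'"
    "twisted_mult s \<Delta> S R (dual_scale c \<beta>) \<alpha> = dual_scale c (twisted_mult s \<Delta> S R \<beta> \<alpha>)"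
    "twisted_mult s \<Delta> S R \<alpha> (dual_scale c \<beta>) = dual_scale c (twisted_mult s \<Delta> S R \<alpha> \<beta>)"
    if "\<alpha> \<in> dual s" "\<beta> \<in> dual s" "\<beta>' \<in> dual s" for \<alpha> \<beta> \<beta>' c
    by (simp_all add: fun_eq_iff tw that add scale dual_scale_apply
        tsum_left_distrib tsum_add distrib_left distrib_right ac_simps)
  show ?thesis
    unfolding algebra_on_def
    by (simp add: vs subspace closed bilinear counit_in_dual twisted_mult_assoc[OF fin]
        twisted_mult_counit_left[OF fin] twisted_mult_counit_right[OF fin])
qed

lemma opposite_algebra: "algebra_on s UNIV (\<lambda>x y. y * x) 1"
  using algebra by (simp add: algebra_on_def)

section \<open>The Drinfeld map as the antipode after the factorisation map\<close>

definition factorisation_map :: "('k \<Rightarrow> 'f) \<Rightarrow> 'k" where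
  "factorisation_map \<alpha> = tsum (Q_element s R) (\<lambda>p q. s (\<alpha> q) p)"

lemma factorisation_map_twisted_mult:
  assumes fin: "finite_dimensional s" and \<alpha>: "\<alpha> \<in> dual s" and \<beta>: "\<beta> \<in> dual s"
  shows "factorisation_map (twisted_mult s \<Delta> S R \<beta> \<alpha>) = factorisation_map \<beta> * factorisation_map \<alpha>"
proof -
  let ?Q = "Q_element s R"
  have \<alpha>\<beta>: "\<alpha> (x + y) = \<alpha> x + \<alpha> y" "\<alpha> (s c x) = c * \<alpha> x"
      "\<beta> (x + y) = \<beta> x + \<beta> y" "\<beta> (s c x) = c * \<beta> x" for x y c
    using \<alpha> \<beta> by (simp_all add: dual_iff)
  have pull: "s (tsum X g) p = tsum X (\<lambda>a b. s (g a b) p)"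
    for X and g :: "'k \<Rightarrow> 'k \<Rightarrow> 'f" and p
    by (rule tsum_additive[where g = "\<lambda>c. s c p"]) (rule scale_add)
  have "factorisation_map (twisted_mult s \<Delta> S R \<beta> \<alpha>) =
      tsum ?Q (\<lambda>p q. tsum R (\<lambda>a b. tsum R (\<lambda>c d. tsum (\<Delta> q) (\<lambda>x y.
        s (\<alpha> (a * c * x) * \<beta> (d * y * S b)) p))))"
    by (simp add: factorisation_map_def twisted_mult_apply[OF fin \<alpha> \<beta>] pull)
  also have "\<dots> = tsum ?Q (\<lambda>p q. tsum ?Q (\<lambda>p' q'. s (\<alpha> q * \<beta> q') (p' * p)))"
    by (rule Q_transports_twisted_product[where f = "\<lambda>u v w. s (\<alpha> v * \<beta> w) u"])
       (simp add: multilinear_simps ac_simps \<alpha>\<beta>)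
  also have "\<dots> = factorisation_map \<beta> * factorisation_map \<alpha>"
    by (simp add: factorisation_map_def tsum_left_distrib tsum_right_distrib tsum_scale mult.commute)
  finally show ?thesis .
qed

lemma factorisation_map_counit: "factorisation_map \<epsilon> = 1"
proof -
  have "factorisation_map \<epsilon> = tsum R (\<lambda>a b. tsum R (\<lambda>c d. s (\<epsilon> a) b * s (\<epsilon> d) c))"
    unfolding factorisation_map_def
    by (subst tsum_Q) (simp_all add: multilinear_simps counit_mult)
  also have "\<dots> = tsum R (\<lambda>a b. s (\<epsilon> a) b) * tsum R (\<lambda>c d. s (\<epsilon> d) c)"
    by (simp only: tsum_right_distrib) (simp only: tsum_left_distrib)
  finally show ?thesis
    by (simp add: counit_R_left counit_R_right)
qed

lemma factorisation_map_linear: "linear_map_on dual_scale (dual s) s UNIV factorisation_map"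
  by (simp add: linear_map_on_def factorisation_map_def dual_scale_def scale_add tsum_add tsum_scale)

lemma factorisable_iff: "factorisable s R \<longleftrightarrow> bij_betw factorisation_map (dual s) UNIV"
proof -
  have "(\<lambda>\<alpha>. \<Sum>(a, b)\<leftarrow>sw (Q_element s R). s (\<alpha> b) a) = factorisation_map"
    by (simp add: fun_eq_iff factorisation_map_def tsum_def)
  then show ?thesis
    by (simp add: factorisable_def linear_iso_on_def factorisation_map_linear)
qed

text \<open>
  If \<open>S(x) = S(y)\<close>, then \<open>u x = S\<^sup>2(x) u = S\<^sup>2(y) u = u y\<close>, so injectivity of \<open>S\<close> comes down to a left
  inverse of \<open>u\<close>.  The ribbon element provides the right inverse \<open>w = S(u) \<nu>\<^sup>-\<^sup>2\<close>.
\<close>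

lemma bij_antipode:
  assumes fin: "finite_dimensional s" and \<nu>: "ribbon_element s \<Delta> \<epsilon> S R \<nu>"
  shows "bij S"
proof -
  let ?u = "drinfeld_element S R"
  obtain B where "finite_dimensional_vector_space s B"
    using fin by (auto simp: finite_dimensional_def)
  then interpret fd: finite_dimensional_vector_space s B .
  obtain \<mu> where \<mu>: "\<nu> * \<mu> = 1" and u: "?u * S ?u = \<nu> * \<nu>"
    using \<nu> unfolding ribbon_element_def power2_eq_square by blast
  define w where "w = S ?u * \<mu> * \<mu>"
  have "?u * w = \<nu> * (\<nu> * \<mu>) * \<mu>"
    unfolding w_def by (simp add: u flip: mult.assoc)
  then have uw: "?u * w = 1"
    by (simp add: \<mu>)
  have "Vector_Spaces.linear s s ((*) w)"
    using vector_space by (simp add: Vector_Spaces.linear_iff distrib_left)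
  \<comment> \<open>left multiplication by \<open>w\<close> is injective, hence surjective by finite dimension, so \<open>w\<close> is invertible\<close>
  moreover have "inj ((*) w)"
  proof (rule injI)
    fix x y
    assume "w * x = w * y"
    then have "?u * w * x = ?u * w * y"
      by (simp only: mult.assoc)
    then show "x = y"
      by (simp add: uw)
  qed
  ultimately have "surj ((*) w)"
    by (rule fd.linear_inj_imp_surj)
  then obtain v where v: "w * v = 1"
    unfolding surj_def by metis
  have "v = ?u * w * v"
    by (simp add: uw)
  also have "\<dots> = ?u"
    by (simp only: mult.assoc v mult_1_right)
  finally have wu: "w * ?u = 1"
    using v by simp
  have "inj S"
  proof (rule injI)
    fix x y
    assume "S x = S y"
    then have "?u * x = ?u * y"
      by (simp flip: antipode_square_drinfeld_element)
    then have "w * ?u * x = w * ?u * y"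
      by (simp only: mult.assoc)
    then show "x = y"
      by (simp add: wu)
  qed
  then show ?thesis
    using fd.linear_inj_imp_surj[OF antipode_linear] by (simp add: bij_def)
qed

text \<open>
  \<open>\<langle>\<alpha> \<circ> S\<inverse>, Q\<^sub>1\<rangle> Q\<^sub>2 = \<langle>\<alpha>, Q\<^sub>2\<rangle> S(Q\<^sub>1)\<close> because \<open>S \<otimes> S\<close> maps \<open>Q\<close> to its flip.
\<close>

lemma drinfeld_map_eq:
  assumes S: "bij S" and \<alpha>: "\<alpha> \<in> dual s"
  shows "drinfeld_map s S R \<alpha> = S (factorisation_map \<alpha>)"
proof -
  let ?\<alpha>' = "dual_antipode_inv s S \<alpha>"
  \<comment> \<open>\<open>dual_antipode_inv\<close> is a choice of preimage, so \<open>\<alpha>\<close> must first be exhibited as \<open>S\<^sup>*(\<alpha> \<circ> S\<inverse>)\<close>\<close>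
  have S_inv: "inv S (S x) = x" "S (inv S x) = x" for x
    using S by (simp_all add: bij_is_inj bij_is_surj surj_f_inv_f)
  have "inv S (x + y) = inv S x + inv S y" "inv S (s c x) = s c (inv S x)" for x y c
    by (metis S_inv antipode_add, metis S_inv antipode_scale)
  then have "\<alpha> \<circ> inv S \<in> dual s"
    using \<alpha> by (simp add: dual_iff)
  moreover have "dual_antipode S (\<alpha> \<circ> inv S) = \<alpha>"
    by (simp add: dual_antipode_def fun_eq_iff S_inv)
  ultimately have img: "\<alpha> \<in> dual_antipode S ` dual s"
    by (metis image_eqI)
  have \<alpha>': "?\<alpha>' \<in> dual s" and \<alpha>'_S: "?\<alpha>' (S x) = \<alpha> x" for x
    using inv_into_into[OF img] f_inv_into_f[OF img]
    by (simp_all add: dual_antipode_inv_def dual_antipode_def fun_eq_iff)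
  have "balanced2 s (\<lambda>p q. s (?\<alpha>' p) q)"
    using \<alpha>' by (simp add: dual_iff multilinear_simps)
  from Q_antipode[OF this]
  have "drinfeld_map s S R \<alpha> = tsum (Q_element s R) (\<lambda>p q. S (s (\<alpha> q) p))"
    by (simp add: drinfeld_map_def tsum_def \<alpha>'_S antipode_scale)
  also have "\<dots> = S (factorisation_map \<alpha>)"
    unfolding factorisation_map_def by (rule tsum_additive[symmetric]) (rule antipode_add)
  finally show ?thesis .
qed

lemma drinfeld_map_hom:
  assumes fin: "finite_dimensional s" and S: "bij S"
  shows "algebra_hom dual_scale (dual s) (twisted_mult s \<Delta> S R) \<epsilon>
           s UNIV (\<lambda>x y. y * x) 1 (drinfeld_map s S R)"
proof -
  note alg = twisted_mult_algebra[OF fin]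
  have closed: "\<alpha> + \<beta> \<in> dual s" "dual_scale c \<alpha> \<in> dual s" "twisted_mult s \<Delta> S R \<beta> \<alpha> \<in> dual s"
    if "\<alpha> \<in> dual s" "\<beta> \<in> dual s" for \<alpha> \<beta> c
    using that alg by (auto simp: dual_iff dual_scale_def algebra_simps algebra_on_def)
  have "linear_map_on dual_scale (dual s) s UNIV (drinfeld_map s S R)"
    using factorisation_map_linear
    by (simp add: linear_map_on_def drinfeld_map_eq[OF S] closed antipode_add antipode_scale)
  then show ?thesis
    by (simp add: algebra_hom_def alg opposite_algebra drinfeld_map_eq[OF S] closed counit_in_dual
        factorisation_map_twisted_mult[OF fin] factorisation_map_counit antipode_mult antipode_one)
qed

lemma bij_betw_drinfeld_map_iff:
  assumes S: "bij S"
  shows "bij_betw (drinfeld_map s S R) (dual s) UNIV \<longleftrightarrow> factorisable s R"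
proof -
  have "bij_betw (drinfeld_map s S R) (dual s) UNIV \<longleftrightarrow> bij_betw (S \<circ> factorisation_map) (dual s) UNIV"
    by (rule bij_betw_cong) (simp add: drinfeld_map_eq[OF S])
  also have "\<dots> \<longleftrightarrow> bij_betw factorisation_map (dual s) UNIV"
    using S by (metis bij_betw_comp_iff2 subset_UNIV)
  finally show ?thesis
    by (simp add: factorisable_iff)
qed

end

theorem proposition3p23:
  fixes s :: "'f::field_char_0 \<Rightarrow> 'k::ring_1 \<Rightarrow> 'k"
    and \<Delta> :: "'k \<Rightarrow> ('k \<times> 'k) list set"
    and \<epsilon> :: "'k \<Rightarrow> 'f"
    and S :: "'k \<Rightarrow> 'k"
    and R :: "('k \<times> 'k) list set"
  assumes "finite_dimensional s"
    and "ribbon_hopf_algebra s \<Delta> \<epsilon> S R"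
  shows "algebra_hom dual_scale (dual s) (twisted_mult s \<Delta> S R) \<epsilon>
           s UNIV (\<lambda>x y. y * x) 1 (drinfeld_map s S R) \<and>
         (algebra_iso dual_scale (dual s) (twisted_mult s \<Delta> S R) \<epsilon>
           s UNIV (\<lambda>x y. y * x) 1 (drinfeld_map s S R)
         \<longleftrightarrow> factorisable s R)"
proof -
  have hopf: "hopf_algebra s \<Delta> \<epsilon> S" and R: "R_matrix s \<Delta> R"
    using assms(2) by (simp_all add: ribbon_hopf_algebra_def)
  interpret quasitriangular_hopf_algebra s \<Delta> \<epsilon> S R
    by (intro quasitriangular_hopf_algebra.intro quasitriangular_hopf_algebra_axioms.intro hopf R)
  have S: "bij S"
    using assms by (auto simp: ribbon_hopf_algebra_def intro: bij_antipode)
  show ?thesis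
    using drinfeld_map_hom[OF assms(1) S] bij_betw_drinfeld_map_iff[OF S]
    by (simp add: algebra_iso_def)
qed

end
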